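(* Suppose that $n\geq 39k$, and $\mathcal{F},\mathcal{G}\subset\binom{[n]}{k}$ are cross-intersecting with $|\mathcal{F}|,|\mathcal{G}|\geq|\mathcal{T}(n,k)|$. Then $\min\{\varrho(\mathcal{F}),\varrho(\mathcal{G})\}>\frac{2}{3}\left(1-\frac{k-2}{n-2}\right)$.
   Context: For positive integers $n\geq k$, $[n]=\{1,\ldots,n\}$ and $\binom{[n]}{k}$ is the collection of all $k$-element subsets of $[n]$. The triangle family is $\mathcal{T}(n,k)=\{F\in\binom{[n]}{k}: |F\cap[3]|\geq 2\}$. Families $\mathcal{F},\mathcal{G}$ are cross-intersecting if $F\cap G\neq\emptyset$ for all $F\in\mathcal{F}$, $G\in\mathcal{G}$. For a family $\mathcal{H}\subset\binom{[n]}{k}$ and $i\in[n]$ put $\mathcal{H}(i)=\{H\setminus\{i\}: i\in H\in\mathcal{H}\}$ and $\varrho(\mathcal{H})=\max_{1\leq i\leq n}|\mathcal{H}(i)|/|\mathcal{H}|$.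
   Formalization: The case k=2 is excluded, since there the bound equals 2/3 and F=G=T(n,2) has ϱ=2/3, so the strict inequality fails; F and G are also assumed nonempty (relevant only for k=1) so that ϱ is defined. *)

theory Defs
  imports Complex_Main
begin

definition ksubsets :: "nat \<Rightarrow> nat \<Rightarrow> nat set set" where
  "ksubsets n k = {F. F \<subseteq> {1..n} \<and> card F = k}"

definition triangle_family :: "nat \<Rightarrow> nat \<Rightarrow> nat set set" where
  "triangle_family n k = {F \<in> ksubsets n k. card (F \<inter> {1..3}) \<ge> 2}"

definition cross_intersecting :: "nat set set \<Rightarrow> nat set set \<Rightarrow> bool" where
  "cross_intersecting \<F> \<G> \<longleftrightarrow> (\<forall>F\<in>\<F>. \<forall>G\<in>\<G>. F \<inter> G \<noteq> {})"

definition link :: "nat set set \<Rightarrow> nat \<Rightarrow> nat set set" where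
  "link \<H> i = {H - {i} | H. H \<in> \<H> \<and> i \<in> H}"

text \<open>The ground set size n is a parameter since a family does not determine it.
  The ratio is meaningful for n at least 1 and nonempty families only
  (division by zero yields 0 here).\<close>

definition rho :: "nat \<Rightarrow> nat set set \<Rightarrow> real" where
  "rho n \<H> = Max ((\<lambda>i. real (card (link \<H> i)) / real (card \<H>)) ` {1..n})"

end

theory Submission
  imports Defs
begin

text \<open>The proof rests on a gap in the possible degrees of a pair of large cross-intersecting families. Let
\<open>N\<close> be the number of \<open>k\<close>-sets through two given points and \<open>R \<le> N / 39\<close> the number through three points;
the triangle family has \<open>3 * N - 2 * R\<close> members. If at least \<open>N\<close> members of one family avoid a vertex \<open>v\<close>,
a cascade of Kruskal--Katona type (\<open>cross_intersecting_bound2\<close>) shows that at most \<open>N + 2 * R\<close> members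
of the other family contain \<open>v\<close>, so that about \<open>2 * N\<close> members of the other family avoid \<open>v\<close>, and the
argument can be turned round. Hence every vertex either has low degree, at most \<open>N + 2 * R\<close>, in both
families, or is avoided by fewer than \<open>N\<close> members of each. A family that violates the theorem has at
least \<open>N\<close> members avoiding any given vertex, so then all degrees are low in both families
(\<open>degree_exceeds\<close>).

Pairs with only low degrees do not exist (\<open>no_low_pair\<close>). To see this, shift such a pair as long as
its degrees remain low. If in the end no further shift changes anything, the ballot lemma
\<open>stable_cross_heavy\<close> says that in one of the families every member, read as a lattice path, reaches a
positive height. There are few such sets without the smallest element, which therefore has a high
degree. Otherwise there is a resistant pair \<open>{i, j}\<close>: shifting \<open>j\<close> to \<open>i\<close> would produce a high degree. By
the gap, about one third of each family contains only \<open>i\<close>, one third only \<open>j\<close>, and one third neither of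
them. A third vertex \<open>l\<close> that lies in more than a few of the members with only \<open>i\<close> would have to lie in
almost all members of two of these classes, so its degree would not be low
(\<open>resistant_no_third_vertex\<close>). It follows that two resistant pairs cannot be disjoint, so both families are
stable outside \<open>{i, j}\<close>. The ballot lemma for the traces of the members with only \<open>i\<close> and of those with
only \<open>j\<close> then supplies such a vertex \<open>l\<close>, namely the least element outside \<open>{i, j}\<close>.

For \<open>k = 1\<close> both families consist of the same singleton.\<close>

section \<open>Shifting a cross-intersecting pair\<close>

text \<open>The classical shift: a member trades \<open>j\<close> for \<open>i\<close> unless the result is already a member,
which is what keeps the shift injective.\<close>
definition shift_set :: "nat \<Rightarrow> nat \<Rightarrow> nat set set \<Rightarrow> nat set \<Rightarrow> nat set" where
  "shift_set i j \<H> H = (if j \<in> H \<and> i \<notin> H \<and> insert i (H - {j}) \<notin> \<H> then insert i (H - {j}) else H)"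

definition shift :: "nat \<Rightarrow> nat \<Rightarrow> nat set set \<Rightarrow> nat set set" where
  "shift i j \<H> = shift_set i j \<H> ` \<H>"

definition stable :: "nat \<Rightarrow> nat \<Rightarrow> nat set set \<Rightarrow> bool" where
  "stable i j \<H> \<longleftrightarrow> (\<forall>H\<in>\<H>. j \<in> H \<longrightarrow> i \<notin> H \<longrightarrow> insert i (H - {j}) \<in> \<H>)"

definition uniform :: "nat set \<Rightarrow> nat \<Rightarrow> nat set set" where
  "uniform V k = {H. H \<subseteq> V \<and> card H = k}"

lemma finite_uniform: "finite V \<Longrightarrow> finite (uniform V k)"
  by (rule finite_subset[of _ "Pow V"]) (auto simp: uniform_def)

lemma finite_subset_uniform: "finite V \<Longrightarrow> \<H> \<subseteq> uniform V k \<Longrightarrow> finite \<H>"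
  by (meson finite_subset finite_uniform)

lemma card_uniform: "finite V \<Longrightarrow> card (uniform V k) = card V choose k"
  unfolding uniform_def by (rule n_subsets)

lemma cross_intersecting_commute:
  "cross_intersecting \<F> \<G> \<Longrightarrow> cross_intersecting \<G> \<F>"
  unfolding cross_intersecting_def by blast

lemma cross_intersectingD:
  "cross_intersecting \<F> \<G> \<Longrightarrow> F \<in> \<F> \<Longrightarrow> G \<in> \<G> \<Longrightarrow> F \<inter> G \<noteq> {}"
  unfolding cross_intersecting_def by blast

lemma inj_on_shift_set: "inj_on (shift_set i j \<H>) \<H>"
proof (rule inj_onI)
  fix H K assume H: "H \<in> \<H>" and K: "K \<in> \<H>" and eq: "shift_set i j \<H> H = shift_set i j \<H> K"
  have undo: "X = insert j (insert i (X - {j}) - {i})" if "j \<in> X" "i \<notin> X" for X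
    using that by auto
  show "H = K"
  proof (cases "shift_set i j \<H> H = H"; cases "shift_set i j \<H> K = K")
    assume "shift_set i j \<H> H \<noteq> H" "shift_set i j \<H> K \<noteq> K"
    then have "j \<in> H" "i \<notin> H" "j \<in> K" "i \<notin> K" "insert i (H - {j}) = insert i (K - {j})"
      using eq by (auto simp: shift_set_def split: if_splits)
    then show "H = K" using undo[of H] undo[of K] by simp
  next
    assume a: "shift_set i j \<H> H = H" "shift_set i j \<H> K = K"
    show "H = K" using eq unfolding a .
  next
    assume a: "shift_set i j \<H> H = H" "shift_set i j \<H> K \<noteq> K"
    then have "shift_set i j \<H> K \<notin> \<H>" by (simp add: shift_set_def split: if_splits)
    then show "H = K" using a(1) eq H by simp
  next
    assume a: "shift_set i j \<H> H \<noteq> H" "shift_set i j \<H> K = K"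
    then have "shift_set i j \<H> H \<notin> \<H>" by (simp add: shift_set_def split: if_splits)
    then show "H = K" using a(2) eq K by simp
  qed
qed

lemma card_shift: "card (shift i j \<H>) = card \<H>"
  unfolding shift_def by (rule card_image[OF inj_on_shift_set])

lemma shift_uniform:
  assumes "\<H> \<subseteq> uniform V k" "i \<in> V" "finite V"
  shows "shift i j \<H> \<subseteq> uniform V k"
proof -
  have "shift_set i j \<H> H \<in> uniform V k" if "H \<in> \<H>" for H
  proof -
    have "H \<in> uniform V k" using that assms(1) by blast
    then have H: "H \<subseteq> V" "card H = k" by (simp_all add: uniform_def)
    then have "finite H" using assms(3) finite_subset by metis
    then have "card (insert i (H - {j})) = k" if "j \<in> H" "i \<notin> H"
      using that H card_Suc_Diff1[of H j] by simp
    then show ?thesis using H assms(2) unfolding shift_set_def uniform_def by auto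
  qed
  then show ?thesis unfolding shift_def by blast
qed

text \<open>If trading \<open>j\<close> for \<open>i\<close> in \<open>F\<close> destroyed the intersection with \<open>G\<close>, then \<open>F\<close> and \<open>G\<close> would meet
in \<open>j\<close> only, and \<open>F\<close> would already miss the set that arises from \<open>G\<close> by the same trade.\<close>
lemma shift_disjoint_step:
  assumes cr: "cross_intersecting \<F> \<G>" and "F \<in> \<F>" "G \<in> \<G>"
    and "j \<in> F" "i \<notin> F" and st: "j \<in> G \<Longrightarrow> i \<notin> G \<Longrightarrow> insert i (G - {j}) \<in> \<G>"
  shows "insert i (F - {j}) \<inter> G \<noteq> {}"
proof
  assume e: "insert i (F - {j}) \<inter> G = {}"
  have iG: "i \<notin> G" and FG: "F \<inter> G \<subseteq> {j}" using e by auto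
  have "F \<inter> G \<noteq> {}" using cross_intersectingD[OF cr] assms by blast
  then have "j \<in> G" using FG by auto
  then have "insert i (G - {j}) \<in> \<G>" using st iG by blast
  then have "F \<inter> insert i (G - {j}) \<noteq> {}" using cross_intersectingD[OF cr] assms by blast
  then show False using e FG assms by auto
qed

lemma cross_intersecting_shift:
  assumes cr: "cross_intersecting \<F> \<G>"
  shows "cross_intersecting (shift i j \<F>) (shift i j \<G>)"
proof -
  have "shift_set i j \<F> F \<inter> shift_set i j \<G> G \<noteq> {}" if F: "F \<in> \<F>" and G: "G \<in> \<G>" for F G
  proof -
    define mF where "mF \<longleftrightarrow> j \<in> F \<and> i \<notin> F \<and> insert i (F - {j}) \<notin> \<F>"
    define mG where "mG \<longleftrightarrow> j \<in> G \<and> i \<notin> G \<and> insert i (G - {j}) \<notin> \<G>"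
    consider "mF" "mG" | "mF" "\<not> mG" | "\<not> mF" "mG" | "\<not> mF" "\<not> mG" by blast
    then show ?thesis
    proof cases
      case 1 then show ?thesis unfolding shift_set_def mF_def mG_def by auto
    next
      case 2
      have "insert i (F - {j}) \<inter> G \<noteq> {}"
        by (rule shift_disjoint_step[OF cr F G]) (use 2 mF_def mG_def in auto)
      moreover have "shift_set i j \<F> F = insert i (F - {j})" "shift_set i j \<G> G = G"
        using 2 unfolding shift_set_def mF_def mG_def by auto
      ultimately show ?thesis by simp
    next
      case 3
      have "insert i (G - {j}) \<inter> F \<noteq> {}"
        by (rule shift_disjoint_step[OF cross_intersecting_commute[OF cr] G F]) (use 3 mF_def mG_def in auto)
      moreover have "shift_set i j \<G> G = insert i (G - {j})" "shift_set i j \<F> F = F"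
        using 3 unfolding shift_set_def mF_def mG_def by auto
      ultimately show ?thesis by (simp add: Int_commute)
    next
      case 4
      have "F \<inter> G \<noteq> {}" using cross_intersectingD[OF cr F G] .
      moreover have "shift_set i j \<F> F = F" "shift_set i j \<G> G = G"
        using 4 unfolding shift_set_def mF_def mG_def by auto
      ultimately show ?thesis by simp
    qed
  qed
  then show ?thesis unfolding cross_intersecting_def shift_def by blast
qed

text \<open>The potential that makes shifting towards small elements terminate.\<close>
definition weight :: "nat set set \<Rightarrow> nat" where
  "weight \<H> = (\<Sum>H\<in>\<H>. \<Sum>H)"

lemma sum_shift_set:
  assumes "finite H" "i < j"
  shows "\<Sum>(shift_set i j \<H> H) \<le> \<Sum>H"
    and "shift_set i j \<H> H \<noteq> H \<Longrightarrow> \<Sum>(shift_set i j \<H> H) < \<Sum>H"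
proof -
  have *: "\<Sum>(insert i (H - {j})) < \<Sum>H" if "j \<in> H" "i \<notin> H"
  proof -
    have "\<Sum>(insert i (H - {j})) = i + \<Sum>(H - {j})" using assms that by simp
    also have "\<dots> < j + \<Sum>(H - {j})" using assms by simp
    also have "\<dots> = \<Sum>H" using sum.remove[of H j id] assms that by simp
    finally show ?thesis .
  qed
  then show "\<Sum>(shift_set i j \<H> H) \<le> \<Sum>H" unfolding shift_set_def using less_imp_le by auto
  show "shift_set i j \<H> H \<noteq> H \<Longrightarrow> \<Sum>(shift_set i j \<H> H) < \<Sum>H"
    using * unfolding shift_set_def by (auto split: if_splits)
qed

lemma weight_shift:
  assumes "finite \<H>" "\<And>H. H \<in> \<H> \<Longrightarrow> finite H" "i < j"
  shows "weight (shift i j \<H>) \<le> weight \<H>"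
    and "\<not> stable i j \<H> \<Longrightarrow> weight (shift i j \<H>) < weight \<H>"
proof -
  have w: "weight (shift i j \<H>) = (\<Sum>H\<in>\<H>. \<Sum>(shift_set i j \<H> H))"
    unfolding weight_def shift_def by (subst sum.reindex[OF inj_on_shift_set]) simp
  show "weight (shift i j \<H>) \<le> weight \<H>"
    unfolding w unfolding weight_def by (rule sum_mono) (use sum_shift_set(1) assms in blast)
  assume "\<not> stable i j \<H>"
  then obtain H where "H \<in> \<H>" "j \<in> H" "i \<notin> H" "insert i (H - {j}) \<notin> \<H>"
    unfolding stable_def by blast
  then have "H \<in> \<H>" "shift_set i j \<H> H \<noteq> H" by (auto simp: shift_set_def)
  then have "\<exists>H\<in>\<H>. \<Sum>(shift_set i j \<H> H) < \<Sum>H"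
    using sum_shift_set(2) assms by blast
  moreover have "\<forall>H\<in>\<H>. \<Sum>(shift_set i j \<H> H) \<le> \<Sum>H"
    using sum_shift_set(1) assms by blast
  ultimately show "weight (shift i j \<H>) < weight \<H>"
    unfolding w unfolding weight_def by (intro sum_strict_mono_ex1 assms(1))
qed

text \<open>Shifting as long as a property \<open>P\<close> survives. In the terminal pair a shift either changes nothing
or destroys \<open>P\<close>; the second alternative is as informative as the first one.\<close>
lemma shift_minimal_pair:
  assumes "P \<F> \<G>"
    and fin: "\<And>\<F> \<G>. P \<F> \<G> \<Longrightarrow> finite \<F> \<and> finite \<G> \<and> (\<forall>H\<in>\<F> \<union> \<G>. finite H)"
  obtains \<F>' \<G>' where "P \<F>' \<G>'"
    and "\<And>i j. i < j \<Longrightarrow> P (shift i j \<F>') (shift i j \<G>') \<Longrightarrow> stable i j \<F>' \<and> stable i j \<G>'"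
proof -
  define m where "m p = weight (fst p) + weight (snd p)" for p :: "nat set set \<times> nat set set"
  obtain p where p: "case_prod P p" and least: "\<And>p'. case_prod P p' \<Longrightarrow> m p \<le> m p'"
    using ex_has_least_nat[of "case_prod P" "(\<F>, \<G>)" m] assms(1) by auto
  obtain \<F>' \<G>' where pe: "p = (\<F>', \<G>')" by (cases p)
  have P: "P \<F>' \<G>'" using p pe by simp
  show ?thesis
  proof (rule that[OF P])
    fix i j :: nat assume ij: "i < j" and "P (shift i j \<F>') (shift i j \<G>')"
    then have "m p \<le> m (shift i j \<F>', shift i j \<G>')" using least by simp
    then have le: "weight \<F>' + weight \<G>' \<le> weight (shift i j \<F>') + weight (shift i j \<G>')"
      by (simp add: pe m_def)
    have F: "finite \<F>'" "\<And>H. H \<in> \<F>' \<Longrightarrow> finite H" and G: "finite \<G>'" "\<And>H. H \<in> \<G>' \<Longrightarrow> finite H"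
      using fin[OF P] by auto
    show "stable i j \<F>' \<and> stable i j \<G>'"
      using le weight_shift[OF F ij] weight_shift[OF G ij] by linarith
  qed
qed

section \<open>Bounds of Kruskal--Katona type for cross-intersecting pairs\<close>

definition avoid :: "nat set set \<Rightarrow> nat \<Rightarrow> nat set set" where
  "avoid \<H> m = {H \<in> \<H>. m \<notin> H}"

definition stable_on :: "nat set \<Rightarrow> nat set set \<Rightarrow> bool" where
  "stable_on V \<H> \<longleftrightarrow> (\<forall>i\<in>V. \<forall>j\<in>V. i < j \<longrightarrow> stable i j \<H>)"

lemma stable_onD:
  "stable_on V \<H> \<Longrightarrow> i \<in> V \<Longrightarrow> j \<in> V \<Longrightarrow> i < j \<Longrightarrow> H \<in> \<H> \<Longrightarrow> j \<in> H \<Longrightarrow> i \<notin> H \<Longrightarrow> insert i (H - {j}) \<in> \<H>"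
  unfolding stable_on_def stable_def by blast

lemma mem_link: "X \<in> link \<H> m \<longleftrightarrow> m \<notin> X \<and> insert m X \<in> \<H>"
proof
  assume "m \<notin> X \<and> insert m X \<in> \<H>"
  then have "X = insert m X - {m} \<and> insert m X \<in> \<H> \<and> m \<in> insert m X" by auto
  then show "X \<in> link \<H> m" unfolding link_def by blast
qed (auto simp: link_def insert_absorb)

lemma card_link: "card (link \<H> m) = card {H \<in> \<H>. m \<in> H}"
proof -
  have "link \<H> m = (\<lambda>H. H - {m}) ` {H \<in> \<H>. m \<in> H}" by (auto simp: link_def)
  moreover have "inj_on (\<lambda>H. H - {m}) {H \<in> \<H>. m \<in> H}"
    by (rule inj_onI) (metis (mono_tags, lifting) insert_Diff mem_Collect_eq)
  ultimately show ?thesis by (simp add: card_image)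
qed

lemma card_avoid_link:
  assumes "finite \<H>"
  shows "card \<H> = card (avoid \<H> m) + card (link \<H> m)"
proof -
  have "\<H> = avoid \<H> m \<union> {H \<in> \<H>. m \<in> H}" by (auto simp: avoid_def)
  moreover have "card (avoid \<H> m \<union> {H \<in> \<H>. m \<in> H}) = card (avoid \<H> m) + card {H \<in> \<H>. m \<in> H}"
    by (rule card_Un_disjoint) (use assms in \<open>auto simp: avoid_def\<close>)
  ultimately show ?thesis by (simp add: card_link)
qed

lemma avoid_uniform: "\<H> \<subseteq> uniform V k \<Longrightarrow> avoid \<H> m \<subseteq> uniform (V - {m}) k"
  by (auto simp: avoid_def uniform_def)

lemma link_uniform:
  assumes "\<H> \<subseteq> uniform V k" "finite V"
  shows "link \<H> m \<subseteq> uniform (V - {m}) (k - 1)"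
proof
  fix X assume "X \<in> link \<H> m"
  then have "m \<notin> X" "insert m X \<in> uniform V k" using assms by (auto simp: mem_link)
  moreover from this have "finite X"
    using assms(2) finite_subset unfolding uniform_def by (metis (mono_tags) finite_insert mem_Collect_eq)
  ultimately show "X \<in> uniform (V - {m}) (k - 1)" by (auto simp: uniform_def)
qed

lemma stable_on_avoid: "stable_on V \<H> \<Longrightarrow> stable_on (V - {m}) (avoid \<H> m)"
  unfolding stable_on_def stable_def avoid_def by auto

lemma stable_on_link: 
  assumes "stable_on V \<H>" shows "stable_on (V - {m}) (link \<H> m)"
  unfolding stable_on_def stable_def
proof (intro ballI impI)
  fix i j H assume "i \<in> V - {m}" "j \<in> V - {m}" "i < j" "H \<in> link \<H> m" "j \<in> H" "i \<notin> H"
  then have "insert i (insert m H - {j}) \<in> \<H>"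
    by (intro stable_onD[OF assms]) (auto simp: mem_link)
  moreover have "insert i (insert m H - {j}) = insert m (insert i (H - {j}))"
    using \<open>j \<in> V - {m}\<close> by auto
  ultimately show "insert i (H - {j}) \<in> link \<H> m"
    using \<open>i \<in> V - {m}\<close> \<open>H \<in> link \<H> m\<close> by (auto simp: mem_link)
qed

lemma cross_intersecting_avoid_avoid:
  "cross_intersecting \<A> \<B> \<Longrightarrow> cross_intersecting (avoid \<A> m) (avoid \<B> m)"
  unfolding cross_intersecting_def avoid_def by blast

lemma cross_intersecting_avoid_link:
  "cross_intersecting \<A> \<B> \<Longrightarrow> cross_intersecting (avoid \<A> m) (link \<B> m)"
  unfolding cross_intersecting_def avoid_def link_def by blast

text \<open>Two members that meet in \<open>Max V\<close> only leave some smaller element of \<open>V\<close> uncovered, because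
\<open>a + b \<le> card V\<close>. Stability trades \<open>Max V\<close> for this element in one of them, which then misses the other.\<close>
lemma cross_intersecting_link_link:
  assumes "cross_intersecting \<A> \<B>" "stable_on V \<A>" "\<A> \<subseteq> uniform V a" "\<B> \<subseteq> uniform V b"
    and "finite V" "V \<noteq> {}" "a + b \<le> card V"
  shows "cross_intersecting (link \<A> (Max V)) (link \<B> (Max V))"
  unfolding cross_intersecting_def
proof (intro ballI notI)
  define m where "m = Max V"
  fix A B assume "A \<in> link \<A> (Max V)" "B \<in> link \<B> (Max V)" and AB: "A \<inter> B = {}"
  then have A: "m \<notin> A" "insert m A \<in> \<A>" and B: "m \<notin> B" "insert m B \<in> \<B>"
    by (auto simp: mem_link m_def)
  have mV: "m \<in> V" using assms by (simp add: m_def)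
  have "insert m A \<in> uniform V a" "insert m B \<in> uniform V b" using A B assms by blast+
  then have u: "A \<subseteq> V" "B \<subseteq> V" "card (insert m A) = a" "card (insert m B) = b"
    by (auto simp: uniform_def)
  have fin: "finite A" "finite B" using u assms finite_subset by metis+
  have "card (insert m (A \<union> B)) \<le> Suc (card A + card B)"
    using fin A B card_Un_le[of A B] by (simp add: card_insert_if)
  also have "\<dots> < card V" using u fin A B assms(7) by simp
  finally have "\<not> V \<subseteq> insert m (A \<union> B)" using card_mono[of "insert m (A \<union> B)" V] fin by auto
  then obtain z where z: "z \<in> V" "z \<noteq> m" "z \<notin> A" "z \<notin> B" by blast
  have "z < m" using z(2) Max_ge[OF assms(5) z(1)] unfolding m_def by linarith
  then have "insert z (insert m A - {m}) \<in> \<A>"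
    using A z mV by (intro stable_onD[OF assms(2)]) auto
  then have "insert z (insert m A - {m}) \<inter> insert m B \<noteq> {}"
    using assms(1) B unfolding cross_intersecting_def by blast
  then show False using z AB A by auto
qed

lemma stable_pair_exists:
  assumes "finite V" "\<A> \<subseteq> uniform V a" "\<B> \<subseteq> uniform V b" "cross_intersecting \<A> \<B>"
  obtains \<A>' \<B>' where "\<A>' \<subseteq> uniform V a" "\<B>' \<subseteq> uniform V b" "cross_intersecting \<A>' \<B>'"
    "stable_on V \<A>'" "stable_on V \<B>'" "card \<A>' = card \<A>" "card \<B>' = card \<B>"
proof -
  define P where "P \<F> \<G> \<longleftrightarrow> \<F> \<subseteq> uniform V a \<and> \<G> \<subseteq> uniform V b \<and> cross_intersecting \<F> \<G>
    \<and> card \<F> = card \<A> \<and> card \<G> = card \<B>" for \<F> \<G>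
  have fin: "finite \<F> \<and> finite \<G> \<and> (\<forall>H\<in>\<F> \<union> \<G>. finite H)" if "P \<F> \<G>" for \<F> \<G>
  proof -
    have s: "\<F> \<subseteq> uniform V a" "\<G> \<subseteq> uniform V b" using that by (simp_all add: P_def)
    have "H \<subseteq> V" if "H \<in> \<F> \<union> \<G>" for H using s that by (auto simp: uniform_def)
    then have "finite H" if "H \<in> \<F> \<union> \<G>" for H
      using that finite_subset[OF _ assms(1)] by metis
    then show ?thesis
      using finite_subset_uniform[OF assms(1) s(1)] finite_subset_uniform[OF assms(1) s(2)] by blast
  qed
  have "P \<A> \<B>" using assms by (simp add: P_def)
  then obtain \<A>' \<B>' where P: "P \<A>' \<B>'"
    and min: "\<And>i j. i < j \<Longrightarrow> P (shift i j \<A>') (shift i j \<B>') \<Longrightarrow> stable i j \<A>' \<and> stable i j \<B>'"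
    using shift_minimal_pair[of P, OF _ fin] by metis
  have "stable i j \<A>' \<and> stable i j \<B>'" if "i \<in> V" "j \<in> V" "i < j" for i j
  proof (rule min[OF \<open>i < j\<close>])
    show "P (shift i j \<A>') (shift i j \<B>')"
      using P that assms(1) unfolding P_def
      by (simp add: shift_uniform cross_intersecting_shift card_shift)
  qed
  then show ?thesis using that[of \<A>' \<B>'] P unfolding P_def stable_on_def by blast
qed

text \<open>Complements of members of \<open>\<A>\<close> have size \<open>b\<close> and cannot belong to \<open>\<B>\<close>.\<close>
lemma card_cross_complement:
  assumes "finite V" "\<A> \<subseteq> uniform V a" "\<B> \<subseteq> uniform V b" "cross_intersecting \<A> \<B>"
    and "a + b = card V"
  shows "card \<A> + card \<B> \<le> card V choose b"
proof -
  have sub: "A \<subseteq> V" if "A \<in> \<A>" for A using that assms(2) by (auto simp: uniform_def)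
  have inj: "inj_on (\<lambda>A. V - A) \<A>"
    by (rule inj_onI) (metis double_diff order_refl sub)
  have im: "(\<lambda>A. V - A) ` \<A> \<subseteq> uniform V b"
  proof
    fix X assume "X \<in> (\<lambda>A. V - A) ` \<A>"
    then obtain A where "A \<in> \<A>" "X = V - A" by blast
    moreover from this have "A \<subseteq> V" "card A = a" using assms(2) by (auto simp: uniform_def)
    ultimately show "X \<in> uniform V b"
      using assms(1,5) by (auto simp: uniform_def card_Diff_subset finite_subset)
  qed
  have disj: "(\<lambda>A. V - A) ` \<A> \<inter> \<B> = {}"
    using assms(4) unfolding cross_intersecting_def by blast
  have "card \<A> + card \<B> = card ((\<lambda>A. V - A) ` \<A> \<union> \<B>)"
    using disj inj assms by (simp add: card_Un_disjoint card_image finite_subset_uniform)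
  also have "\<dots> \<le> card (uniform V b)"
    using im assms by (intro card_mono) (auto simp: finite_uniform)
  finally show ?thesis using assms by (simp add: card_uniform)
qed

text \<open>A common induction for bounds of Kruskal--Katona type, stated for cross-intersecting pairs instead of
shadows: if \<open>\<A>\<close> has at least \<open>f (card V) a\<close> members, then at least \<open>h (card V) b\<close> of the
\<open>b\<close>-sets are missing from \<open>\<B>\<close>. Split both families by whether \<open>m = Max V\<close> is contained. For a stable
pair all four combinations of the parts are again cross-intersecting, so the part of \<open>\<A>\<close> that is
still large bounds both parts of \<open>\<B>\<close>. Therefore \<open>f\<close> and \<open>h\<close> only have to satisfy Pascal-like
recursions and to fit on the boundary \<open>a + b = card V\<close>.\<close>
lemma cross_intersecting_bound_stable:
  fixes f h :: "nat \<Rightarrow> nat \<Rightarrow> nat"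
  assumes base: "\<And>V \<A> \<B> b. \<lbrakk>finite V; \<A> \<subseteq> uniform V s; \<B> \<subseteq> uniform V b; cross_intersecting \<A> \<B>;
      stable_on V \<A>; f (card V) s \<le> card \<A>; s + b \<le> card V\<rbrakk> \<Longrightarrow> card \<B> + h (card V) b \<le> card V choose b"
    and compl: "\<And>a b. s \<le> a \<Longrightarrow> h (a + b) b \<le> f (a + b) a"
    and empty: "\<And>M. h M 0 \<le> 1"
    and pos: "\<And>M a. s \<le> a \<Longrightarrow> a \<le> M \<Longrightarrow> 0 < f M a"
    and f_rec: "\<And>M a. s < a \<Longrightarrow> a < M \<Longrightarrow> f M a + f M (a - 1) \<le> Suc (f (Suc M) a)"
    and h_rec: "\<And>M a b. s < a \<Longrightarrow> 0 < b \<Longrightarrow> a + b \<le> M \<Longrightarrow> h (Suc M) b \<le> h M b + h M (b - 1)"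
    and "finite V" "\<A> \<subseteq> uniform V a" "\<B> \<subseteq> uniform V b" "cross_intersecting \<A> \<B>"
    and "stable_on V \<A>" "stable_on V \<B>" "s \<le> a" "a + b \<le> card V" "f (card V) a \<le> card \<A>"
  shows "card \<B> + h (card V) b \<le> card V choose b"
  using assms(7-)
proof (induction "card V" arbitrary: V \<A> \<B> a b)
  case 0
  then show ?case using base[of V \<A> \<B> b] by auto
next
  case (Suc M)
  note \<A> = Suc.prems(2) and \<B> = Suc.prems(3) and cross = Suc.prems(4)
    and st = Suc.prems(5,6)
  have finA: "finite \<A>" and finB: "finite \<B>" using Suc.prems finite_subset_uniform by blast+
  consider "a = s" | "a + b = Suc M" | "b = 0" | "s < a" "0 < b" "a + b \<le> M"
    using Suc.prems Suc.hyps(2) by linarith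
  then show ?case
  proof cases
    case 1
    then show ?thesis using base[of V \<A> \<B> b] Suc.prems by blast
  next
    case 2
    then have "card \<A> + card \<B> \<le> card V choose b"
      using card_cross_complement[of V \<A> a \<B> b] Suc.prems Suc.hyps(2) by simp
    moreover have "h (card V) b \<le> f (card V) a" using 2 compl[of a b] Suc by simp
    ultimately show ?thesis using Suc.prems by linarith
  next
    case 3
    have "0 < f (card V) a" using pos[of a "card V"] Suc.prems by simp
    then have "\<A> \<noteq> {}" using Suc.prems by auto
    then have "{} \<notin> \<B>" using cross unfolding cross_intersecting_def by auto
    moreover have "B = {}" if "B \<in> \<B>" for B
    proof -
      have "B \<subseteq> V" "card B = 0" using that \<B> 3 by (auto simp: uniform_def)
      then show ?thesis using Suc.prems(1) finite_subset by (metis card_0_eq)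
    qed
    ultimately have "\<B> = {}" by blast
    then show ?thesis using 3 empty by simp
  next
    case 4
    define m where "m = Max V"
    have V0: "V \<noteq> {}" using Suc.hyps(2) by auto
    have mV: "m \<in> V" using Suc.prems(1) V0 by (simp add: m_def)
    let ?V = "V - {m}"
    have cV: "card ?V = M" "M = card ?V" using Suc.hyps(2) mV Suc.prems(1) by simp_all
    have finV: "finite ?V" using Suc.prems(1) by simp
    let ?A0 = "avoid \<A> m" and ?A1 = "link \<A> m" and ?B0 = "avoid \<B> m" and ?B1 = "link \<B> m"
    note u = avoid_uniform[OF \<A>, of m] link_uniform[OF \<A> Suc.prems(1), of m]
      avoid_uniform[OF \<B>, of m] link_uniform[OF \<B> Suc.prems(1), of m]
    note st' = stable_on_avoid[OF st(1), of m] stable_on_link[OF st(1), of m]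
      stable_on_avoid[OF st(2), of m] stable_on_link[OF st(2), of m]
    have c00: "cross_intersecting ?A0 ?B0" by (rule cross_intersecting_avoid_avoid[OF cross])
    have c01: "cross_intersecting ?A0 ?B1" by (rule cross_intersecting_avoid_link[OF cross])
    have c10: "cross_intersecting ?A1 ?B0"
      by (rule cross_intersecting_commute[OF cross_intersecting_avoid_link[OF cross_intersecting_commute[OF cross]]])
    have c11: "cross_intersecting ?A1 ?B1"
      unfolding m_def
      by (rule cross_intersecting_link_link[OF cross st(1) \<A> \<B> Suc.prems(1) V0]) (use Suc.prems in simp)
    note splitA = card_avoid_link[OF finA, of m] and splitB = card_avoid_link[OF finB, of m]
    have "f M a + f M (a - 1) \<le> Suc (card \<A>)"
      using f_rec[of a M] 4 Suc.prems(9) Suc.hyps(2) by (metis Suc_le_mono add_gr_0 le_trans less_add_same_cancel1 order_less_le_trans)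
    then consider "f M a \<le> card ?A0" | "f M (a - 1) \<le> card ?A1" using splitA by linarith
    then have "card ?B0 + h M b \<le> M choose b \<and> card ?B1 + h M (b - 1) \<le> M choose (b - 1)"
    proof cases
      case 1
      have "card ?B0 + h (card ?V) b \<le> card ?V choose b"
        by (rule Suc.hyps(1)[OF cV(2) finV u(1) u(3) c00 st'(1) st'(3)]) (use 1 4 cV(1) in simp_all)
      moreover have "card ?B1 + h (card ?V) (b - 1) \<le> card ?V choose (b - 1)"
        by (rule Suc.hyps(1)[OF cV(2) finV u(1) u(4) c01 st'(1) st'(4)]) (use 1 4 cV(1) in simp_all)
      ultimately show ?thesis unfolding cV(1) by simp
    next
      case 2
      have "card ?B0 + h (card ?V) b \<le> card ?V choose b"
        by (rule Suc.hyps(1)[OF cV(2) finV u(2) u(3) c10 st'(2) st'(3)]) (use 2 4 cV(1) in simp_all)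
      moreover have "card ?B1 + h (card ?V) (b - 1) \<le> card ?V choose (b - 1)"
        by (rule Suc.hyps(1)[OF cV(2) finV u(2) u(4) c11 st'(2) st'(4)]) (use 2 4 cV(1) in simp_all)
      ultimately show ?thesis unfolding cV(1) by simp
    qed
    moreover have "h (Suc M) b \<le> h M b + h M (b - 1)" using h_rec 4 by blast
    moreover have "Suc M choose b = (M choose b) + (M choose (b - 1))"
      using 4 choose_reduce_nat[of "Suc M" b] by simp
    ultimately show ?thesis using splitB Suc.hyps(2) by simp
  qed
qed

text \<open>The extremal case is \<open>\<A>\<close> consisting of all sets that contain a fixed \<open>s\<close>-set and \<open>\<B>\<close> consisting of
all sets that meet it.\<close>
lemma cross_intersecting_bound:
  assumes "finite V" "\<A> \<subseteq> uniform V a" "\<B> \<subseteq> uniform V b" "cross_intersecting \<A> \<B>"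
    and "s \<le> a" "a + b \<le> card V" "(card V - s) choose (a - s) \<le> card \<A>"
  shows "card \<B> + ((card V - s) choose b) \<le> card V choose b"
proof -
  obtain \<A>' \<B>' where *: "\<A>' \<subseteq> uniform V a" "\<B>' \<subseteq> uniform V b" "cross_intersecting \<A>' \<B>'"
    "stable_on V \<A>'" "stable_on V \<B>'" and c: "card \<A>' = card \<A>" "card \<B>' = card \<B>"
    using stable_pair_exists[OF assms(1-4)] .
  define f where "f M a = (M - s) choose (a - s)" for M a
  define h where "h M b = (M - s) choose b" for M b
  have "card \<B>' + h (card V) b \<le> card V choose b"
  proof (rule cross_intersecting_bound_stable[of s f h, OF _ _ _ _ _ _ assms(1) * assms(5,6)])
    fix V :: "nat set" and \<A> \<B> b
    assume V: "finite V" "\<A> \<subseteq> uniform V s" "\<B> \<subseteq> uniform V b" "cross_intersecting \<A> \<B>"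
      and "f (card V) s \<le> card \<A>"
    then obtain A where A: "A \<in> \<A>" unfolding f_def by fastforce
    then have AV: "A \<subseteq> V" "card A = s" using V by (auto simp: uniform_def)
    have disj: "\<B> \<inter> uniform (V - A) b = {}"
      using A V(4) unfolding cross_intersecting_def uniform_def by blast
    have "card \<B> + card (uniform (V - A) b) = card (\<B> \<union> uniform (V - A) b)"
      using disj V by (simp add: card_Un_disjoint finite_uniform finite_subset_uniform)
    also have "\<dots> \<le> card (uniform V b)"
      using V by (intro card_mono) (auto simp: finite_uniform uniform_def)
    finally show "card \<B> + h (card V) b \<le> card V choose b"
      using V AV by (simp add: card_uniform h_def card_Diff_subset finite_subset)
  next
    fix a b assume "s \<le> a"
    then show "h (a + b) b \<le> f (a + b) a"
      using binomial_symmetric[of b "a + b - s"] unfolding f_def h_def by simp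
  next
    fix M a assume "s < a" "a < M"
    then show "f M a + f M (a - 1) \<le> Suc (f (Suc M) a)"
      using choose_reduce_nat[of "Suc M - s" "a - s"] unfolding f_def by simp
  next
    fix M a b :: nat assume "s < a" "0 < b" "a + b \<le> M"
    then show "h (Suc M) b \<le> h M b + h M (b - 1)"
      using choose_reduce_nat[of "Suc M - s" b] unfolding h_def by simp
  qed (use assms(7) in \<open>simp_all add: f_def h_def c\<close>)
  then show ?thesis using c by (simp add: h_def)
qed

text \<open>Two disjoint edges turn into two that share a point when the larger of their second end points is
shifted to the smaller one. This starts the induction for the next bound.\<close>
lemma stable_pairs_sharing_point:
  assumes "finite V" "\<A> \<subseteq> uniform V 2" "stable_on V \<A>" "2 \<le> card \<A>"
  obtains x y z where "{x, y} \<in> \<A>" "{x, z} \<in> \<A>" "x \<noteq> y" "x \<noteq> z" "y \<noteq> z"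
proof -
  have "\<exists>S T. S \<in> \<A> \<and> T \<in> \<A> \<and> S \<noteq> T"
    using assms(4) card_le_Suc0_iff_eq[of \<A>] finite_subset_uniform[OF assms(1,2)] by fastforce
  then obtain S T where ST: "S \<in> \<A>" "T \<in> \<A>" "S \<noteq> T" by blast
  obtain u v where S: "S = {u, v}" "u \<noteq> v" "u \<in> V" "v \<in> V"
    using ST(1) assms(2) by (auto simp: uniform_def card_2_iff)
  obtain x y where T: "T = {x, y}" "x \<noteq> y" "x \<in> V" "y \<in> V"
    using ST(2) assms(2) by (auto simp: uniform_def card_2_iff)
  show ?thesis
  proof (cases "S \<inter> T = {}")
    case False
    then show ?thesis using S T ST that by (metis Int_emptyI doubleton_eq_iff insertE singletonD)
  next
    case True
    then consider "v < y" | "y < v" using S T by fastforce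
    then show ?thesis
    proof cases
      case 1
      then have "insert v (T - {y}) \<in> \<A>"
        using True S T ST by (intro stable_onD[OF assms(3)]) auto
      moreover have "insert v (T - {y}) = {v, x}" using T by auto
      moreover have "{v, u} \<in> \<A>" using S ST by (simp add: insert_commute)
      ultimately show ?thesis using that[of v u x] True S T by auto
    next
      case 2
      then have "insert y (S - {v}) \<in> \<A>"
        using True S T ST by (intro stable_onD[OF assms(3)]) auto
      moreover have "insert y (S - {v}) = {y, u}" using S by auto
      moreover have "{y, x} \<in> \<A>" using T ST by (simp add: insert_commute)
      ultimately show ?thesis using that[of y x u] True S T by auto
    qed
  qed
qed

text \<open>The second cascade. The extremal \<open>\<A>\<close> consists of the sets containing \<open>{1, 2}\<close> or \<open>{1, 3, 4}\<close>;
then \<open>\<B>\<close> consists of the sets that contain \<open>1\<close>, or \<open>2\<close> together with \<open>3\<close> or \<open>4\<close>. When the sets are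
small compared with \<open>V\<close>, the few members of \<open>\<A>\<close> in excess of those containing \<open>{1, 2}\<close> roughly halve
the bound on \<open>\<B>\<close>.\<close>
lemma cross_intersecting_bound2:
  assumes "finite V" "\<A> \<subseteq> uniform V a" "\<B> \<subseteq> uniform V b" "cross_intersecting \<A> \<B>"
    and "3 \<le> a" "0 < b" "a + b \<le> card V"
    and "((card V - 2) choose (a - 2)) + ((card V - 4) choose (a - 3)) \<le> card \<A>"
  shows "card \<B> + ((card V - 2) choose b) + ((card V - 4) choose (b - 1)) \<le> card V choose b"
proof -
  obtain \<A>' \<B>' where *: "\<A>' \<subseteq> uniform V a" "\<B>' \<subseteq> uniform V b" "cross_intersecting \<A>' \<B>'"
    "stable_on V \<A>'" "stable_on V \<B>'" and c: "card \<A>' = card \<A>" "card \<B>' = card \<B>"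
    using stable_pair_exists[OF assms(1-4)] .
  \<comment> \<open>Two members instead of one for \<open>a = 2\<close>: the recursion allows a deficit of \<open>1\<close>, and a single edge
      would be too weak a start.\<close>
  define f where "f M a = (if a = 2 then 2 else ((M - 2) choose (a - 2)) + ((M - 4) choose (a - 3)))" for M a :: nat
  define h where "h M b = ((M - 2) choose b) + (if b = 0 then 0 else (M - 4) choose (b - 1))" for M b :: nat
  have a2: "2 \<le> a" using assms by simp
  have "card \<B>' + h (card V) b \<le> card V choose b"
  proof (rule cross_intersecting_bound_stable[of 2 f h, OF _ _ _ _ _ _ assms(1) * a2 assms(7)])
    fix V :: "nat set" and \<A> \<B> b
    assume V: "finite V" "\<A> \<subseteq> uniform V 2" "\<B> \<subseteq> uniform V b" "cross_intersecting \<A> \<B>"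
      "stable_on V \<A>" and "f (card V) 2 \<le> card \<A>" and le: "2 + b \<le> card V"
    then obtain x y z where S: "{x, y} \<in> \<A>" and T: "{x, z} \<in> \<A>" and ne: "x \<noteq> y" "x \<noteq> z" "y \<noteq> z"
      using stable_pairs_sharing_point[of V \<A>] by (metis f_def)
    have xyz: "x \<in> V" "y \<in> V" "z \<in> V" using S T V(2) by (auto simp: uniform_def)
    define \<C> where "\<C> = (if b = 0 then {} else insert y ` uniform (V - {x, y, z}) (b - 1))"
    have cxyz: "card (V - {x, y, z}) = card V - 3" and cxy: "card (V - {x, y}) = card V - 2"
      using xyz ne V(1) by (simp_all add: card_Diff_subset)
    have cC: "card \<C> = (if b = 0 then 0 else (card V - 3) choose (b - 1))"
    proof (cases "b = 0")
      case False
      have "inj_on (insert y) (uniform (V - {x, y, z}) (b - 1))"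
        by (rule inj_onI) (auto simp: uniform_def insert_ident subset_iff)
      then show ?thesis using False V(1) cxyz by (simp add: \<C>_def card_image card_uniform)
    qed (simp add: \<C>_def)
    have finU: "finite (uniform (V - {x, y}) b)" "finite \<C>" "finite \<B>"
      using V finite_uniform[of "V - {x,y}"] finite_uniform[of "V - {x,y,z}"]
      by (auto simp: \<C>_def intro: finite_subset_uniform)
    have CU: "\<C> \<subseteq> uniform V b"
    proof
      fix C assume "C \<in> \<C>"
      then obtain D where D: "C = insert y D" "D \<subseteq> V - {x, y, z}" "card D = b - 1" "0 < b"
        by (auto simp: \<C>_def uniform_def split: if_splits)
      have "finite D" using D(2) V(1) by (meson finite_Diff finite_subset)
      moreover have "y \<notin> D" using D by blast
      ultimately show "C \<in> uniform V b" using D xyz by (auto simp: uniform_def)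
    qed
    have avoidS: "B \<inter> {x, y} \<noteq> {}" "B \<inter> {x, z} \<noteq> {}" if "B \<in> \<B>" for B
      using cross_intersectingD[OF V(4) S that] cross_intersectingD[OF V(4) T that] by blast+
    have d1: "\<B> \<inter> uniform (V - {x, y}) b = {}" using avoidS(1) unfolding uniform_def by blast
    have "C \<inter> {x, z} = {} \<and> y \<in> C" if "C \<in> \<C>" for C
      using that ne by (auto simp: \<C>_def uniform_def split: if_splits)
    then have d2: "(\<B> \<union> uniform (V - {x, y}) b) \<inter> \<C> = {}"
      using avoidS(2) unfolding uniform_def by fastforce
    have "card \<B> + card (uniform (V - {x, y}) b) + card \<C> = card (\<B> \<union> uniform (V - {x, y}) b \<union> \<C>)"
      using d1 d2 finU by (simp add: card_Un_disjoint)
    also have "\<dots> \<le> card (uniform V b)"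
      using V CU by (intro card_mono) (auto simp: finite_uniform uniform_def)
    finally have "card \<B> + ((card V - 2) choose b) + (if b = 0 then 0 else (card V - 3) choose (b - 1)) \<le> card V choose b"
      using V cxy cC by (simp add: card_uniform)
    moreover have "(card V - 4) choose (b - 1) \<le> (card V - 3) choose (b - 1)"
      by (rule binomial_right_mono) simp
    ultimately show "card \<B> + h (card V) b \<le> card V choose b"
      unfolding h_def by (auto split: if_splits)
  next
    fix a b :: nat assume "2 \<le> a"
    show "h (a + b) b \<le> f (a + b) a"
    proof (cases "a = 2")
      case True
      then show ?thesis by (cases "b \<le> 1") (auto simp: h_def f_def le_Suc_eq binomial_eq_0)
    next
      case False
      have "b \<le> a + b - 2" "a + b - 2 - b = a - 2" using \<open>2 \<le> a\<close> by auto
      then have "(a + b - 2) choose b = (a + b - 2) choose (a - 2)"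
        using binomial_symmetric[of b "a + b - 2"] by metis
      moreover have "(a + b - 4) choose (b - 1) = (a + b - 4) choose (a - 3)" if "0 < b"
      proof -
        have "b - 1 \<le> a + b - 4" "a + b - 4 - (b - 1) = a - 3" using that False \<open>2 \<le> a\<close> by auto
        then show ?thesis using binomial_symmetric[of "b - 1" "a + b - 4"] by metis
      qed
      ultimately show ?thesis using False by (simp add: h_def f_def)
    qed
  next
    fix M a :: nat assume "2 < a" "a < M"
    then show "f M a + f M (a - 1) \<le> Suc (f (Suc M) a)"
      using choose_reduce_nat[of "Suc M - 2" "a - 2"] choose_reduce_nat[of "Suc M - 4" "a - 3"]
      by (cases "a = 3") (auto simp: f_def numeral_eq_Suc)
  next
    fix M a b :: nat assume "2 < a" "0 < b" "a + b \<le> M"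
    then show "h (Suc M) b \<le> h M b + h M (b - 1)"
      using choose_reduce_nat[of "Suc M - 2" b] choose_reduce_nat[of "Suc M - 4" "b - 1"]
      by (cases "b = 1") (auto simp: h_def numeral_eq_Suc)
  next
    fix M a :: nat assume "2 \<le> a" "a \<le> M"
    then show "0 < f M a" by (simp add: f_def) arith
  qed (use assms in \<open>simp_all add: f_def h_def c\<close>)
  then show ?thesis using c assms by (simp add: h_def)
qed

section \<open>Sections and their traces\<close>

text \<open>The section of \<open>\<H>\<close> given by the points \<open>X\<close> that are required and the points \<open>Y\<close> that are forbidden.\<close>
definition sec :: "nat set set \<Rightarrow> nat set \<Rightarrow> nat set \<Rightarrow> nat set set" where
  "sec \<H> X Y = {H \<in> \<H>. X \<subseteq> H \<and> H \<inter> Y = {}}"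

text \<open>The members of a section with their common part removed: a family on the ground set without
\<open>X \<union> Y\<close>.\<close>
definition trace :: "nat set set \<Rightarrow> nat set \<Rightarrow> nat set \<Rightarrow> nat set set" where
  "trace \<H> X Y = (\<lambda>H. H - X) ` sec \<H> X Y"

lemma mem_trace:
  assumes "X \<inter> Y = {}"
  shows "A \<in> trace \<H> X Y \<longleftrightarrow> A \<union> X \<in> \<H> \<and> A \<inter> X = {} \<and> A \<inter> Y = {}"
proof
  assume "A \<in> trace \<H> X Y"
  then obtain H where "H \<in> \<H>" "X \<subseteq> H" "H \<inter> Y = {}" "A = H - X"
    unfolding trace_def sec_def by blast
  moreover from this have "A \<union> X = H" by blast
  ultimately show "A \<union> X \<in> \<H> \<and> A \<inter> X = {} \<and> A \<inter> Y = {}" by auto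
next
  assume a: "A \<union> X \<in> \<H> \<and> A \<inter> X = {} \<and> A \<inter> Y = {}"
  then have "A = (A \<union> X) - X" "A \<union> X \<in> sec \<H> X Y" using assms unfolding sec_def by auto
  then show "A \<in> trace \<H> X Y" unfolding trace_def by blast
qed

lemma card_trace: "card (trace \<H> X Y) = card (sec \<H> X Y)"
  unfolding trace_def
proof (rule card_image, rule inj_onI)
  fix H K assume "H \<in> sec \<H> X Y" "K \<in> sec \<H> X Y" and eq: "H - X = K - X"
  then have "X \<subseteq> H" "X \<subseteq> K" by (simp_all add: sec_def)
  then have "H = (H - X) \<union> X" "K = (K - X) \<union> X" by blast+
  then show "H = K" using eq by simp
qed

lemma trace_uniform:
  assumes "\<H> \<subseteq> uniform V k" "finite V"
  shows "trace \<H> X Y \<subseteq> uniform (V - (X \<union> Y)) (k - card X)"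
proof
  fix A assume "A \<in> trace \<H> X Y"
  then obtain H where H: "H \<in> \<H>" "X \<subseteq> H" "H \<inter> Y = {}" "A = H - X"
    unfolding trace_def sec_def by blast
  have "H \<subseteq> V" "card H = k" using H(1) assms(1) by (auto simp: uniform_def)
  moreover have "finite X" using \<open>H \<subseteq> V\<close> H(2) assms(2) by (meson finite_subset)
  ultimately show "A \<in> uniform (V - (X \<union> Y)) (k - card X)"
    using H by (auto simp: uniform_def card_Diff_subset)
qed

lemma card_sec_uniform:
  assumes "finite V" "X \<subseteq> V" "Y \<subseteq> V" "X \<inter> Y = {}" "card X \<le> k"
  shows "card (sec (uniform V k) X Y) = (card V - card X - card Y) choose (k - card X)"
proof -
  have fX: "finite X" and fY: "finite Y" using assms finite_subset by blast+
  have "trace (uniform V k) X Y = uniform (V - (X \<union> Y)) (k - card X)"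
  proof
    show "uniform (V - (X \<union> Y)) (k - card X) \<subseteq> trace (uniform V k) X Y"
    proof
      fix A assume "A \<in> uniform (V - (X \<union> Y)) (k - card X)"
      then have A: "A \<subseteq> V - (X \<union> Y)" "card A = k - card X" by (auto simp: uniform_def)
      have "finite A" using A(1) assms(1) by (meson finite_Diff finite_subset)
      moreover have "A \<inter> X = {}" using A(1) by blast
      ultimately have "card (A \<union> X) = k" using A(2) assms(5) fX by (simp add: card_Un_disjoint)
      then show "A \<in> trace (uniform V k) X Y"
        using A(1) assms(2,4) by (auto simp: mem_trace uniform_def)
    qed
  qed (use assms(1) in \<open>intro trace_uniform, auto\<close>)
  then have "card (sec (uniform V k) X Y) = card (V - (X \<union> Y)) choose (k - card X)"
    using assms(1) by (metis card_trace card_uniform finite_Diff)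
  moreover have "card (V - (X \<union> Y)) = card V - card X - card Y"
    using assms fX fY by (simp add: card_Diff_subset card_Un_disjoint)
  ultimately show ?thesis by simp
qed

lemma card_sec_le:
  assumes "\<H> \<subseteq> uniform V k" "finite V" "X \<subseteq> V" "card X \<le> k"
  shows "card (sec \<H> X {}) \<le> (card V - card X) choose (k - card X)"
proof -
  have "card (sec \<H> X {}) \<le> card (sec (uniform V k) X {})"
    using assms(1,2) by (intro card_mono) (auto simp: sec_def finite_uniform)
  then show ?thesis using card_sec_uniform[of V X "{}" k] assms by simp
qed

lemma cross_intersecting_trace:
  assumes "cross_intersecting \<F> \<G>" "X \<subseteq> Y'" "X' \<subseteq> Y"
  shows "cross_intersecting (trace \<F> X Y) (trace \<G> X' Y')"
  unfolding cross_intersecting_def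
proof (intro ballI)
  fix A B assume "A \<in> trace \<F> X Y" "B \<in> trace \<G> X' Y'"
  then obtain F G where F: "F \<in> \<F>" "F \<inter> Y = {}" "A = F - X" and G: "G \<in> \<G>" "G \<inter> Y' = {}" "B = G - X'"
    unfolding trace_def sec_def by blast
  obtain e where "e \<in> F" "e \<in> G" using cross_intersectingD[OF assms(1) F(1) G(1)] by blast
  then have "e \<in> A \<inter> B" using F(2,3) G(2,3) assms(2,3) by blast
  then show "A \<inter> B \<noteq> {}" by blast
qed

lemma stable_trace:
  assumes "stable i j \<H>" "i \<notin> X \<union> Y" "j \<notin> X \<union> Y" "X \<inter> Y = {}"
  shows "stable i j (trace \<H> X Y)"
  unfolding stable_def
proof (intro ballI impI)
  fix A assume A: "A \<in> trace \<H> X Y" "j \<in> A" "i \<notin> A"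
  then have "A \<union> X \<in> \<H>" "j \<in> A \<union> X" "i \<notin> A \<union> X"
    using assms(2,4) by (auto simp: mem_trace)
  then have "insert i (A \<union> X - {j}) \<in> \<H>"
    using assms(1)[unfolded stable_def, rule_format, of "A \<union> X"] by simp
  moreover have "insert i (A \<union> X - {j}) = insert i (A - {j}) \<union> X" using assms(3) by auto
  ultimately show "insert i (A - {j}) \<in> trace \<H> X Y"
    using A assms(2-4) by (auto simp: mem_trace)
qed

text \<open>If \<open>X \<subseteq> Y'\<close> and \<open>X' \<subseteq> Y\<close>, members of the two sections can meet only outside \<open>X \<union> Y\<close>, so the bound
for cross-intersecting families applies to their traces.\<close>
lemma section_bound:
  assumes "finite V" "\<F> \<subseteq> uniform V k" "\<G> \<subseteq> uniform V k" "cross_intersecting \<F> \<G>"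
    and "X \<subseteq> Y'" "X' \<subseteq> Y" "X \<union> Y = X' \<union> Y'" "X \<union> Y \<subseteq> V"
    and "s \<le> k - card X" "(k - card X) + (k - card X') \<le> card V - card (X \<union> Y)"
    and "(card V - card (X \<union> Y) - s) choose (k - card X - s) \<le> card (sec \<F> X Y)"
  shows "card (sec \<G> X' Y') + ((card V - card (X \<union> Y) - s) choose (k - card X'))
    \<le> (card V - card (X \<union> Y)) choose (k - card X')"
proof -
  have c: "card (V - (X \<union> Y)) = card V - card (X \<union> Y)"
    using assms(1,8) by (meson card_Diff_subset finite_subset)
  have "card (trace \<G> X' Y') + ((card (V - (X \<union> Y)) - s) choose (k - card X'))
    \<le> card (V - (X \<union> Y)) choose (k - card X')"
  proof (rule cross_intersecting_bound)
    show "trace \<F> X Y \<subseteq> uniform (V - (X \<union> Y)) (k - card X)"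
      by (rule trace_uniform[OF assms(2,1)])
    show "trace \<G> X' Y' \<subseteq> uniform (V - (X \<union> Y)) (k - card X')"
      unfolding assms(7) by (rule trace_uniform[OF assms(3,1)])
    show "cross_intersecting (trace \<F> X Y) (trace \<G> X' Y')"
      by (rule cross_intersecting_trace[OF assms(4-6)])
  qed (use assms c in \<open>simp_all add: card_trace\<close>)
  then show ?thesis by (simp add: c card_trace)
qed

section \<open>The ballot lemma and heavy sets\<close>

text \<open>Otherwise choose a violating pair with \<open>A \<inter> B\<close> as small as possible and let \<open>x\<close> be the least common
element. Up to \<open>x\<close> the two sets do not cover \<open>V\<close>, and moving \<open>x\<close> in \<open>A\<close> down to an uncovered \<open>z\<close>
keeps the pair violating: between \<open>z\<close> and \<open>x\<close> the sets are disjoint and left out \<open>z\<close>. This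
reduces the intersection, which cannot become empty.\<close>
lemma stable_cross_ballot:
  assumes "stable_on V \<A>" "cross_intersecting \<A> \<B>" "finite V"
    and "\<And>H. H \<in> \<A> \<union> \<B> \<Longrightarrow> H \<subseteq> V" and "A \<in> \<A>" "B \<in> \<B>"
  shows "\<exists>x\<in>V. card (V \<inter> {..x}) < card (A \<inter> {..x}) + card (B \<inter> {..x})"
  using assms(5)
proof (induction "card (A \<inter> B)" arbitrary: A rule: less_induct)
  case less
  show ?case
  proof (rule ccontr)
    assume "\<not> ?case"
    then have bal: "card (A \<inter> {..x}) + card (B \<inter> {..x}) \<le> card (V \<inter> {..x})" if "x \<in> V" for x
      using that by fastforce
    have AV: "A \<subseteq> V" and BV: "B \<subseteq> V" using assms(4,6) less.prems by blast+
    have fin: "finite A" "finite B" using AV BV assms(3) finite_subset by blast+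
    have ne: "A \<inter> B \<noteq> {}" using cross_intersectingD[OF assms(2) less.prems assms(6)] .
    define x where "x = Min (A \<inter> B)"
    have x: "x \<in> A" "x \<in> B" "x \<in> V" using Min_in[of "A \<inter> B"] ne fin AV by (auto simp: x_def)
    have x_min: "x \<le> y" if "y \<in> A" "y \<in> B" for y using that fin by (simp add: x_def)
    have "card (A \<inter> {..x} \<union> B \<inter> {..x}) < card (V \<inter> {..x})"
    proof -
      have "card (A \<inter> {..x}) + card (B \<inter> {..x})
          = card (A \<inter> {..x} \<union> B \<inter> {..x}) + card (A \<inter> {..x} \<inter> (B \<inter> {..x}))"
        using fin by (intro card_Un_Int) auto
      moreover have "0 < card (A \<inter> {..x} \<inter> (B \<inter> {..x}))"
        using x fin by (auto simp: card_gt_0_iff)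
      ultimately show ?thesis using bal[OF x(3)] by linarith
    qed
    then have "\<not> V \<inter> {..x} \<subseteq> A \<inter> {..x} \<union> B \<inter> {..x}"
      using card_mono[of "A \<inter> {..x} \<union> B \<inter> {..x}" "V \<inter> {..x}"] fin by auto
    then obtain z where z: "z \<in> V" "z \<le> x" "z \<notin> A" "z \<notin> B" by auto
    have zx: "z < x" using z x by (metis le_neq_implies_less)
    define A' where "A' = insert z (A - {x})"
    have A': "A' \<in> \<A>" unfolding A'_def
      by (rule stable_onD[OF assms(1) z(1) x(3) zx less.prems x(1) z(3)])
    have "A' \<inter> B = A \<inter> B - {x}" using z by (auto simp: A'_def)
    then have "card (A' \<inter> B) < card (A \<inter> B)" using x fin card_Diff1_less[of "A \<inter> B" x] by simp
    from less.hyps[OF this A'] obtain y where y: "y \<in> V"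
      "card (V \<inter> {..y}) < card (A' \<inter> {..y}) + card (B \<inter> {..y})" by blast
    consider "y < z" | "z \<le> y" "y < x" | "x \<le> y" by linarith
    then show False
    proof cases
      case 1
      then have "A' \<inter> {..y} = A \<inter> {..y}" using zx by (auto simp: A'_def)
      then show False using bal[OF y(1)] y(2) by simp
    next
      case 2
      then have "A' \<inter> {..y} = insert z (A \<inter> {..y})" by (auto simp: A'_def)
      then have 1: "card (A' \<inter> {..y}) = Suc (card (A \<inter> {..y}))" using z fin by simp
      have "A \<inter> {..y} \<inter> (B \<inter> {..y}) = {}" using x_min 2 by fastforce
      then have "card (A \<inter> {..y}) + card (B \<inter> {..y}) = card (A \<inter> {..y} \<union> B \<inter> {..y})"
        using fin by (intro card_Un_disjoint[symmetric]) auto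
      also have "\<dots> < card (insert z (A \<inter> {..y} \<union> B \<inter> {..y}))" using z fin by simp
      also have "\<dots> \<le> card (V \<inter> {..y})"
        using AV BV z 2 assms(3) by (intro card_mono) auto
      finally show False using y(2) 1 by simp
    next
      case 3
      then have "A' \<inter> {..y} = insert z (A \<inter> {..y} - {x})" using zx by (auto simp: A'_def)
      then have "card (A' \<inter> {..y}) = Suc (card (A \<inter> {..y} - {x}))" using z fin by simp
      also have "\<dots> = card (A \<inter> {..y})" using card_Suc_Diff1[of "A \<inter> {..y}" x] fin x 3 by simp
      finally show False using bal[OF y(1)] y(2) by simp
    qed
  qed
qed

text \<open>As a lattice path with a step up at each element of \<open>H\<close> and a step down at each other element of
\<open>V\<close>, the set \<open>H\<close> reaches a positive height.\<close>
definition heavy :: "nat set \<Rightarrow> nat set \<Rightarrow> bool" where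
  "heavy V H \<longleftrightarrow> (\<exists>x\<in>V. card (V \<inter> {..x}) < 2 * card (H \<inter> {..x}))"

lemma stable_cross_heavy:
  assumes "stable_on V \<A>" "cross_intersecting \<A> \<B>" "finite V"
    and "\<And>H. H \<in> \<A> \<union> \<B> \<Longrightarrow> H \<subseteq> V"
  shows "(\<forall>A\<in>\<A>. heavy V A) \<or> (\<forall>B\<in>\<B>. heavy V B)"
proof (rule ccontr)
  assume "\<not> ?thesis"
  then obtain A B where AB: "A \<in> \<A>" "\<not> heavy V A" "B \<in> \<B>" "\<not> heavy V B" by blast
  obtain x where x: "x \<in> V" "card (V \<inter> {..x}) < card (A \<inter> {..x}) + card (B \<inter> {..x})"
    using stable_cross_ballot[OF assms AB(1,3)] by blast
  have "2 * card (A \<inter> {..x}) \<le> card (V \<inter> {..x})" "2 * card (B \<inter> {..x}) \<le> card (V \<inter> {..x})"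
    using AB x(1) by (auto simp: heavy_def not_less)
  then show False using x(2) by linarith
qed

lemma binomial_diagonal_decay:
  fixes c :: nat
  assumes "c * r \<le> m" "1 \<le> c" "t \<le> r"
  shows "c ^ t * ((m - t) choose (r - t)) \<le> m choose r"
  using assms(1,3)
proof (induction t arbitrary: m r)
  case (Suc t)
  obtain r' where r: "r = Suc r'" using Suc.prems by (cases r) auto
  obtain m' where m: "m = Suc m'" using Suc.prems r assms(2) by (cases m) auto
  have "c * r' \<le> m'" using Suc.prems(1) assms(2) by (simp add: r m)
  then have "c ^ t * ((m' - t) choose (r' - t)) \<le> m' choose r'"
    using Suc.IH[of r' m'] Suc.prems(2) r by simp
  then have "c ^ Suc t * ((m - Suc t) choose (r - Suc t)) \<le> c * (m' choose r')"
    by (simp add: r m)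
  moreover have "c * (m' choose r') \<le> m choose r"
  proof -
    have "r * (c * (m' choose r')) \<le> m * (m' choose r')"
      using mult_le_mono1[OF Suc.prems(1), of "m' choose r'"] by (simp add: algebra_simps)
    also have "\<dots> = r * (m choose r)" using Suc_times_binomial_eq[of m' r'] by (simp add: r m mult.commute)
    finally show ?thesis using r by (metis Suc_mult_le_cancel1)
  qed
  ultimately show ?case by linarith
qed simp

text \<open>By induction: consecutive values have a ratio of at most \<open>4\<close>. The bound \<open>4 ^ (t + 1)\<close> would make the
count of heavy sets too large for the contradiction with low degrees.\<close>
lemma central_binomial_bound: "(2 * Suc t) choose (t + 2) \<le> 4 ^ t"
proof (induction t)
  case 0
  show ?case by (simp add: numeral_eq_Suc)
next
  case (Suc t)
  define h where "h = Suc t"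
  have 1: "(h + 2) * (2 * Suc h choose (h + 2)) = (2 * h + 2) * (2 * h + 1 choose (h + 1))"
    using Suc_times_binomial_eq[of "2 * h + 1" "h + 1"] by (simp add: mult.commute)
  have 2: "2 * h + 1 choose (h + 1) = 2 * h + 1 choose h"
    using binomial_symmetric[of h "2 * h + 1"] by simp
  have 3: "h * (2 * h + 1 choose h) = (2 * h + 1) * (2 * h choose t)"
    using Suc_times_binomial_eq[of "2 * h" t] by (simp add: h_def mult.commute)
  have 4: "2 * h choose t = 2 * h choose (t + 2)"
    using binomial_symmetric[of t "2 * h"] by (simp add: h_def)
  have "h * ((h + 2) * (2 * Suc h choose (h + 2))) = (2 * h + 2) * (h * (2 * h + 1 choose h))"
    by (metis 1 2 mult.left_commute)
  also have "\<dots> = ((2 * h + 2) * (2 * h + 1)) * (2 * h choose (t + 2))"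
    unfolding 3 4 by (rule mult.assoc[symmetric])
  also have "\<dots> \<le> (4 * (h * (h + 2))) * (2 * h choose (t + 2))"
    by (intro mult_le_mono1) (simp add: h_def algebra_simps)
  finally have "(h * (h + 2)) * (2 * Suc h choose (h + 2)) \<le> (h * (h + 2)) * (4 * (2 * h choose (t + 2)))"
    by (simp only: mult.assoc mult.left_commute mult.commute)
  then have "2 * Suc h choose (h + 2) \<le> 4 * (2 * h choose (t + 2))"
    unfolding mult_le_cancel1 by (simp only: h_def) simp
  also have "\<dots> \<le> 4 * 4 ^ t" using Suc.IH by (simp add: h_def)
  finally show ?case by (simp add: h_def)
qed

text \<open>A path that starts with a step down and still reaches a positive height has, for some \<open>h = t + 1\<close>, at
least \<open>h + 1\<close> of its up steps among the positions \<open>2, \<dots>, 2 * h + 1\<close>.\<close>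
lemma heavy_avoiding_Min_covered:
  assumes "finite V" "V \<noteq> {}"
  defines "Y \<equiv> \<lambda>h. {z \<in> V. z \<noteq> Min V \<and> card (V \<inter> {..z}) \<le> 2 * h + 1}"
  assumes H: "H \<in> uniform V b" "Min V \<notin> H" "heavy V H"
  shows "\<exists>t<b - 1. \<exists>S\<in>uniform (Y (Suc t)) (t + 2). S \<subseteq> H"
proof -
  obtain x where x: "x \<in> V" "card (V \<inter> {..x}) < 2 * card (H \<inter> {..x})"
    using H(3) by (auto simp: heavy_def)
  have HV: "H \<subseteq> V" "card H = b" using H(1) by (auto simp: uniform_def)
  have finH: "finite H" using HV assms(1) finite_subset by blast
  have "H \<inter> {..x} \<noteq> {}" using x(2) by auto
  then obtain u where u: "u \<in> H" "u \<le> x" by auto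
  have "{Min V, u} \<subseteq> V \<inter> {..x}" using u HV assms(1,2) x(1) by auto
  then have "card {Min V, u} \<le> card (V \<inter> {..x})" using assms(1) by (intro card_mono) auto
  moreover have "card {Min V, u} = 2" using u H(2) by (metis card_2_iff)
  ultimately have c2: "2 \<le> card (H \<inter> {..x})" using x(2) by linarith
  define t where "t = card (H \<inter> {..x}) - 2"
  have ct: "card (H \<inter> {..x}) = t + 2" using c2 by (simp add: t_def)
  have "card (H \<inter> {..x}) \<le> b" using HV finH by (metis card_mono inf_le1)
  then have tb: "t < b - 1" using ct by linarith
  have "H \<inter> {..x} \<subseteq> Y (Suc t)"
  proof
    fix z assume z: "z \<in> H \<inter> {..x}"
    then have "card (V \<inter> {..z}) \<le> card (V \<inter> {..x})" using assms(1) by (intro card_mono) auto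
    then show "z \<in> Y (Suc t)" using z HV H(2) x(2) ct unfolding Y_def by auto
  qed
  then have "H \<inter> {..x} \<in> uniform (Y (Suc t)) (t + 2)" using ct by (simp add: uniform_def)
  then show ?thesis using tb by blast
qed

lemma card_low_rank:
  assumes "finite V" "V \<noteq> {}"
  shows "card {z \<in> V. z \<noteq> Min V \<and> card (V \<inter> {..z}) \<le> 2 * h + 1} \<le> 2 * h"
proof -
  define r where "r z = card (V \<inter> {..z})" for z
  have mono: "r z < r w" if "z \<in> V" "w \<in> V" "z < w" for z w
    unfolding r_def
  proof (rule psubset_card_mono)
    have "w \<in> V \<inter> {..w}" "w \<notin> V \<inter> {..z}" using that by auto
    moreover have "V \<inter> {..z} \<subseteq> V \<inter> {..w}" using that by auto
    ultimately show "V \<inter> {..z} \<subset> V \<inter> {..w}" by blast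
  qed (use assms(1) in simp)
  have inj: "inj_on r V"
  proof (rule inj_onI)
    fix z w assume "z \<in> V" "w \<in> V" "r z = r w"
    then show "z = w" using mono[of z w] mono[of w z] by (cases z w rule: linorder_cases) auto
  qed
  have "Min V \<in> V \<inter> {..Min V}" using assms by simp
  then have "r (Min V) \<ge> 1" unfolding r_def using assms(1) by (metis One_nat_def Suc_leI card_gt_0_iff empty_iff finite_Int)
  moreover have "r (Min V) < r z" if "z \<in> V" "z \<noteq> Min V" for z
  proof (rule mono)
    show "Min V < z" using Min_le[OF assms(1) that(1)] that(2) by simp
  qed (use assms that in auto)
  ultimately have "2 \<le> r z" if "z \<in> V" "z \<noteq> Min V" for z using that by fastforce
  then have "r ` {z \<in> V. z \<noteq> Min V \<and> r z \<le> 2 * h + 1} \<subseteq> {2..2 * h + 1}" by auto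
  then have "card (r ` {z \<in> V. z \<noteq> Min V \<and> r z \<le> 2 * h + 1}) \<le> card {2..2 * h + 1}"
    by (intro card_mono) auto
  moreover have "card (r ` {z \<in> V. z \<noteq> Min V \<and> r z \<le> 2 * h + 1}) = card {z \<in> V. z \<noteq> Min V \<and> r z \<le> 2 * h + 1}"
    by (rule card_image, rule inj_on_subset[OF inj]) auto
  ultimately show ?thesis by (simp add: r_def)
qed

text \<open>The union bound over \<open>heavy_avoiding_Min_covered\<close> has terms bounded by the powers of \<open>4 / 39\<close>, and \<open>1 / (1 - 4 / 39) < 6 / 5\<close>.\<close>
lemma card_heavy_avoiding_Min:
  assumes "finite V" "2 \<le> b" "39 * (b - 2) \<le> card V - 2" "2 \<le> card V"
  shows "real (card {H \<in> uniform V b. Min V \<notin> H \<and> heavy V H}) \<le> 6 / 5 * real ((card V - 2) choose (b - 2))"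
proof -
  have V0: "V \<noteq> {}" using assms by auto
  define M where "M = card V"
  define Y where "Y = (\<lambda>h. {z \<in> V. z \<noteq> Min V \<and> card (V \<inter> {..z}) \<le> 2 * h + 1})"
  define C where "C = (M - 2) choose (b - 2)"
  let ?N = "{H \<in> uniform V b. Min V \<notin> H \<and> heavy V H}"
  let ?U = "\<lambda>t. \<Union>S\<in>uniform (Y (Suc t)) (t + 2). sec (uniform V b) S {}"
  have YV: "Y h \<subseteq> V" for h by (auto simp: Y_def)
  have finY: "finite (Y h)" for h using YV assms(1) finite_subset by blast
  have "?N \<subseteq> (\<Union>t<b - 1. ?U t)"
  proof
    fix H assume "H \<in> ?N"
    then show "H \<in> (\<Union>t<b - 1. ?U t)"
      using heavy_avoiding_Min_covered[OF assms(1) V0, of H b] unfolding Y_def sec_def by auto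
  qed
  moreover have "finite (\<Union>t<b - 1. ?U t)"
    using assms(1) by (intro finite_UN_I finite_uniform finY) (auto simp: sec_def finite_uniform)
  ultimately have "card ?N \<le> card (\<Union>t<b - 1. ?U t)" by (rule card_mono[rotated])
  also have "\<dots> \<le> (\<Sum>t<b - 1. card (?U t))" by (rule card_UN_le) simp
  finally have le: "card ?N \<le> (\<Sum>t<b - 1. card (?U t))" .
  have U: "real (card (?U t)) \<le> (4 / 39) ^ t * real C" if t: "t < b - 1" for t
  proof -
    have "card (?U t) \<le> (\<Sum>S\<in>uniform (Y (Suc t)) (t + 2). card (sec (uniform V b) S {}))"
      by (rule card_UN_le) (rule finite_uniform[OF finY])
    also have "\<dots> \<le> (\<Sum>S\<in>uniform (Y (Suc t)) (t + 2). (M - 2 - t) choose (b - 2 - t))"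
    proof (rule sum_mono)
      fix S assume "S \<in> uniform (Y (Suc t)) (t + 2)"
      then have "S \<subseteq> V" "card S = t + 2" using YV by (auto simp: uniform_def)
      then show "card (sec (uniform V b) S {}) \<le> (M - 2 - t) choose (b - 2 - t)"
        using card_sec_le[of "uniform V b" V b S] assms(1) t by (simp add: M_def)
    qed
    also have "\<dots> = (card (Y (Suc t)) choose (t + 2)) * ((M - 2 - t) choose (b - 2 - t))"
      by (simp add: card_uniform finY)
    also have "\<dots> \<le> 4 ^ t * ((M - 2 - t) choose (b - 2 - t))"
    proof (rule mult_le_mono1)
      have "card (Y (Suc t)) \<le> 2 * Suc t" unfolding Y_def by (rule card_low_rank[OF assms(1) V0])
      then show "card (Y (Suc t)) choose (t + 2) \<le> 4 ^ t"
        by (rule order_trans[OF binomial_right_mono central_binomial_bound])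
    qed
    finally have 1: "card (?U t) \<le> 4 ^ t * ((M - 2 - t) choose (b - 2 - t))" .
    have 2: "39 ^ t * ((M - 2 - t) choose (b - 2 - t)) \<le> C"
      unfolding C_def by (rule binomial_diagonal_decay) (use assms t in \<open>auto simp: M_def\<close>)
    have "39 ^ t * card (?U t) \<le> 4 ^ t * (39 ^ t * ((M - 2 - t) choose (b - 2 - t)))"
      using mult_le_mono2[OF 1, of "39 ^ t"] by (simp add: algebra_simps)
    also have "\<dots> \<le> 4 ^ t * C" using 2 by simp
    finally have "real (39 ^ t * card (?U t)) \<le> real (4 ^ t * C)" by (rule of_nat_mono)
    then show ?thesis by (simp add: power_divide field_simps)
  qed
  have "real (card ?N) \<le> (\<Sum>t<b - 1. real (card (?U t)))" using of_nat_mono[OF le, where ?'a = real] by simp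
  also have "\<dots> \<le> (\<Sum>t<b - 1. (4 / 39) ^ t * real C)" by (rule sum_mono) (use U in auto)
  also have "\<dots> = (\<Sum>t<b - 1. (4 / 39) ^ t) * real C" by (simp add: sum_distrib_right)
  also have "\<dots> \<le> 6 / 5 * real C"
  proof (rule mult_right_mono)
    have "1 - (4 / 39 :: real) ^ (b - 1) = 35 / 39 * (\<Sum>t<b - 1. (4 / 39) ^ t)"
      by (subst one_diff_power_eq) simp
    moreover have "(0::real) \<le> (4 / 39) ^ (b - 1)" by simp
    ultimately have "35 / 39 * (\<Sum>t<b - 1. (4 / 39) ^ t) \<le> (1 :: real)" by linarith
    then show "(\<Sum>t<b - 1. (4 / 39) ^ t) \<le> (6 / 5 :: real)" by linarith
  qed simp
  finally show ?thesis by (simp add: C_def M_def)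
qed

section \<open>Degrees in pairs of large cross-intersecting families\<close>

lemma card_sec_split:
  assumes "finite \<H>" "v \<notin> X" "v \<notin> Y"
  shows "card (sec \<H> X Y) = card (sec \<H> (insert v X) Y) + card (sec \<H> X (insert v Y))"
proof -
  have "sec \<H> X Y = sec \<H> (insert v X) Y \<union> sec \<H> X (insert v Y)" by (auto simp: sec_def)
  moreover have "card (sec \<H> (insert v X) Y \<union> sec \<H> X (insert v Y))
      = card (sec \<H> (insert v X) Y) + card (sec \<H> X (insert v Y))"
    by (rule card_Un_disjoint) (use assms in \<open>auto simp: sec_def\<close>)
  ultimately show ?thesis by simp
qed

lemma card_sec_shift_le:
  assumes "finite \<H>" "v \<noteq> i"
  shows "card (sec (shift i j \<H>) {v} {}) \<le> card (sec \<H> {v} {})"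
proof -
  have "sec (shift i j \<H>) {v} {} \<subseteq> shift_set i j \<H> ` sec \<H> {v} {}"
    using assms(2) unfolding sec_def shift_def shift_set_def by auto
  moreover have fin: "finite (sec \<H> {v} {})" using assms(1) by (simp add: sec_def)
  ultimately have "card (sec (shift i j \<H>) {v} {}) \<le> card (shift_set i j \<H> ` sec \<H> {v} {})"
    by (intro card_mono) auto
  also have "\<dots> \<le> card (sec \<H> {v} {})" using fin by (rule card_image_le)
  finally show ?thesis .
qed

lemma sec_avoid_shift_subset: "sec \<H> {} {i, j} \<subseteq> sec (shift i j \<H>) {} {i}"
proof
  fix H assume "H \<in> sec \<H> {} {i, j}"
  then have "H \<in> \<H>" "i \<notin> H" "shift_set i j \<H> H = H" by (auto simp: sec_def shift_set_def)
  then show "H \<in> sec (shift i j \<H>) {} {i}" unfolding sec_def shift_def by force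
qed

text \<open>All counts are compared with \<open>N\<close>, the number of \<open>k\<close>-sets through two given points. The number \<open>R\<close> of
\<open>k\<close>-sets through three given points is the unit of all error terms; the hypothesis on \<open>n\<close> enters as
\<open>39 * R \<le> N\<close>. In these terms the triangle family has \<open>3 * N - 2 * R\<close> members.\<close>
locale large_ground_set =
  fixes n k :: nat
  assumes k3: "3 \<le> k" and nk: "39 * k \<le> n"
begin

definition N :: real where "N = real ((n - 2) choose (k - 2))"
definition R :: real where "R = real ((n - 3) choose (k - 3))"

lemma N_pos: "0 < N"
proof -
  have "k - 2 \<le> n - 2" using nk by linarith
  then show ?thesis by (simp add: N_def zero_less_binomial)
qed

lemma R_eq: "(real n - 2) * R = (real k - 2) * N"
proof -
  have "Suc (k - 3) * (Suc (n - 3) choose Suc (k - 3)) = ((n - 3) choose (k - 3)) * Suc (n - 3)"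
    by (metis Suc_times_binomial_eq mult.commute)
  moreover have s: "Suc (k - 3) = k - 2" "Suc (n - 3) = n - 2" using k3 nk by auto
  ultimately have "(k - 2) * ((n - 2) choose (k - 2)) = ((n - 3) choose (k - 3)) * (n - 2)" by metis
  then have "real (k - 2) * N = R * real (n - 2)"
    unfolding N_def R_def by (metis of_nat_mult)
  moreover have "real (k - 2) = real k - 2" "real (n - 2) = real n - 2" using k3 nk by auto
  ultimately show ?thesis by (simp add: mult.commute)
qed

lemma R_nonneg: "0 \<le> R" by (simp add: R_def)

lemma R_le: "39 * R \<le> N"
proof -
  have "39 * real k \<le> real n" using of_nat_mono[OF nk, where ?'a = real] by simp
  then have "39 * (real k - 2) \<le> real n - 2" and "real k - 2 > 0" using k3 by auto
  then have "39 * (real k - 2) * R \<le> (real k - 2) * N"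
    using mult_right_mono[OF _ R_nonneg] R_eq by metis
  then have "(real k - 2) * (39 * R) \<le> (real k - 2) * N" by (simp only: mult.commute mult.left_commute)
  then show ?thesis using \<open>real k - 2 > 0\<close> by (simp only: mult_le_cancel_left_pos)
qed

lemma choose_k3_le: "real ((n - 3 - j) choose (k - 3)) \<le> R"
  unfolding R_def by (intro of_nat_mono binomial_right_mono) simp

lemma choose_k2_eq: "real ((n - 3) choose (k - 2)) = N - R"
proof -
  have "0 < n - 2" "0 < k - 2" using k3 nk by auto
  then show ?thesis
    using choose_reduce_nat[of "n - 2" "k - 2"] by (simp add: N_def R_def numeral_eq_Suc)
qed

lemma choose_k2_diff:
  assumes "s \<le> 3"
  shows "real ((n - 3) choose (k - 2)) \<le> real ((n - 3 - s) choose (k - 2)) + real s * R"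
  using assms
proof (induction s)
  case (Suc s)
  have "0 < n - 3 - s" "0 < k - 2" using Suc.prems k3 nk by auto
  then have "(n - 3 - s) choose (k - 2) = ((n - 3 - Suc s) choose (k - 3)) + ((n - 3 - Suc s) choose (k - 2))"
    using choose_reduce_nat[of "n - 3 - s" "k - 2"] by (simp add: numeral_eq_Suc)
  then have "real ((n - 3 - s) choose (k - 2)) \<le> R + real ((n - 3 - Suc s) choose (k - 2))"
    using choose_k3_le[of "Suc s"] by simp
  then show ?case using Suc by (simp add: algebra_simps)
qed simp

abbreviation V :: "nat set" where "V \<equiv> {1..n}"

abbreviation d :: "nat set set \<Rightarrow> nat set \<Rightarrow> nat set \<Rightarrow> real" where
  "d \<H> X Y \<equiv> real (card (sec \<H> X Y))"

lemma card_triangle_family: "3 * N - 2 * R \<le> real (card (triangle_family n k))"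
proof -
  let ?S = "sec (uniform V k)"
  let ?U = "?S {1, 2, 3} {} \<union> (?S {1, 2} {3} \<union> (?S {1, 3} {2} \<union> ?S {2, 3} {1}))"
  have V3: "{1, 2, 3} \<subseteq> V" using k3 nk by auto
  have fin: "finite (?S X Y)" for X Y by (simp add: sec_def finite_uniform)
  have "?U \<subseteq> triangle_family n k"
  proof
    fix H assume H: "H \<in> ?U"
    then have "{1, 2} \<subseteq> H \<or> {1, 3} \<subseteq> H \<or> {2, 3} \<subseteq> H" by (auto simp: sec_def)
    moreover have "{1, 2} \<subseteq> {1..3::nat}" "{1, 3} \<subseteq> {1..3::nat}" "{2, 3} \<subseteq> {1..3::nat}" by auto
    moreover have "(1::nat) \<noteq> 2" "(1::nat) \<noteq> 3" "(2::nat) \<noteq> 3" by auto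
    ultimately obtain x y where "x \<noteq> y" "{x, y} \<subseteq> H \<inter> {1..3}" by (metis le_inf_iff)
    then have "card {x, y} \<le> card (H \<inter> {1..3})" by (intro card_mono) auto
    then have "2 \<le> card (H \<inter> {1..3})" using \<open>x \<noteq> y\<close> by simp
    then show "H \<in> triangle_family n k"
      using H by (auto simp: triangle_family_def ksubsets_def sec_def uniform_def)
  qed
  moreover have "finite (triangle_family n k)"
    by (rule finite_subset[OF _ finite_uniform[of V k]]) (auto simp: triangle_family_def ksubsets_def uniform_def)
  ultimately have "card ?U \<le> card (triangle_family n k)" by (rule card_mono[rotated])
  moreover have "card ?U = card (?S {1, 2, 3} {}) + (card (?S {1, 2} {3}) + (card (?S {1, 3} {2}) + card (?S {2, 3} {1})))"
  proof -
    have 1: "?S {1, 3} {2} \<inter> ?S {2, 3} {1} = {}" by (auto simp: sec_def)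
    have 2: "?S {1, 2} {3} \<inter> (?S {1, 3} {2} \<union> ?S {2, 3} {1}) = {}" by (auto simp: sec_def)
    have 3: "?S {1, 2, 3} {} \<inter> (?S {1, 2} {3} \<union> (?S {1, 3} {2} \<union> ?S {2, 3} {1})) = {}"
      by (auto simp: sec_def)
    show ?thesis using 1 2 3 fin by (simp add: card_Un_disjoint)
  qed
  moreover have "card (?S {1, 2, 3} {}) = (n - 3) choose (k - 3)"
    "card (?S {1, 2} {3}) = (n - 3) choose (k - 2)" "card (?S {1, 3} {2}) = (n - 3) choose (k - 2)"
    "card (?S {2, 3} {1}) = (n - 3) choose (k - 2)"
    using V3 k3 by (simp_all add: card_sec_uniform numeral_2_eq_2[symmetric] numeral_3_eq_3[symmetric])
  ultimately have "real ((n - 3) choose (k - 3)) + 3 * real ((n - 3) choose (k - 2)) \<le> real (card (triangle_family n k))"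
    by linarith
  then show ?thesis unfolding choose_k2_eq R_def[symmetric] by (simp add: algebra_simps)
qed

definition large_pair :: "nat set set \<Rightarrow> nat set set \<Rightarrow> bool" where
  "large_pair \<F> \<G> \<longleftrightarrow> \<F> \<subseteq> uniform V k \<and> \<G> \<subseteq> uniform V k \<and> cross_intersecting \<F> \<G>
    \<and> 3 * N - 2 * R \<le> real (card \<F>) \<and> 3 * N - 2 * R \<le> real (card \<G>)"

text \<open>Vertex degrees are at most about one third of the triangle family; the exact value is the one that
the second cascade produces.\<close>
definition low :: "nat set set \<Rightarrow> bool" where
  "low \<H> \<longleftrightarrow> (\<forall>v\<in>V. d \<H> {v} {} \<le> N + 2 * R)"

lemma large_pair_commute: "large_pair \<F> \<G> \<Longrightarrow> large_pair \<G> \<F>"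
  by (auto simp: large_pair_def intro: cross_intersecting_commute)

lemma large_pair_finite: "large_pair \<F> \<G> \<Longrightarrow> finite \<F>"
  using finite_subset_uniform[of V \<F> k] by (simp add: large_pair_def)

lemma large_pair_shift:
  assumes "large_pair \<F> \<G>" "i \<in> V"
  shows "large_pair (shift i j \<F>) (shift i j \<G>)"
  using assms unfolding large_pair_def
  by (simp add: shift_uniform cross_intersecting_shift card_shift)

lemma d_split1:
  assumes "finite \<H>"
  shows "real (card \<H>) = d \<H> {v} {} + d \<H> {} {v}"
  using card_sec_split[OF assms, of v "{}" "{}"] by (simp add: sec_def)

lemma d_split:
  assumes "finite \<H>" "v \<notin> X" "v \<notin> Y"
  shows "d \<H> X Y = d \<H> (insert v X) Y + d \<H> X (insert v Y)"
  using card_sec_split[OF assms] by simp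

text \<open>If \<open>N\<close> members of \<open>\<F>\<close> avoid \<open>v\<close>, then there are slightly more of them than sets through two fixed
points other than \<open>v\<close>, and the second cascade bounds the members of \<open>\<G>\<close> through \<open>v\<close>.\<close>
lemma degree_drop:
  assumes lp: "large_pair \<F> \<G>" and v: "v \<in> V" and "N \<le> d \<F> {} {v}"
  shows "d \<G> {v} {} \<le> N + 2 * R"
proof -
  have F: "\<F> \<subseteq> uniform V k" and G: "\<G> \<subseteq> uniform V k" and cr: "cross_intersecting \<F> \<G>"
    using lp by (simp_all add: large_pair_def)
  let ?V = "V - {v}"
  have cV: "card ?V = n - 1" using v by simp
  have "card (trace \<G> {v} {}) + ((card ?V - 2) choose (k - 1)) + ((card ?V - 4) choose (k - 1 - 1)) \<le> card ?V choose (k - 1)"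
  proof (rule cross_intersecting_bound2)
    show "trace \<F> {} {v} \<subseteq> uniform ?V k" using trace_uniform[OF F, of "{}" "{v}"] by simp
    show "trace \<G> {v} {} \<subseteq> uniform ?V (k - 1)" using trace_uniform[OF G, of "{v}" "{}"] by simp
    show "cross_intersecting (trace \<F> {} {v}) (trace \<G> {v} {})"
      by (rule cross_intersecting_trace[OF cr]) auto
    have "real ((n - 3) choose (k - 2)) + real ((n - 3 - 2) choose (k - 3)) \<le> d \<F> {} {v}"
      using choose_k2_eq choose_k3_le[of 2] assms(3) by linarith
    then show "((card ?V - 2) choose (k - 2)) + ((card ?V - 4) choose (k - 3)) \<le> card (trace \<F> {} {v})"
      unfolding cV card_trace by (simp add: numeral_2_eq_2[symmetric] numeral_3_eq_3[symmetric])
    show "k + (k - 1) \<le> card ?V" unfolding cV using k3 nk by linarith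
    show "0 < k - 1" using k3 by simp
  qed (use k3 in simp_all)
  then have le: "card (sec \<G> {v} {}) + ((n - 3) choose (k - 1)) + ((n - 3 - 2) choose (k - 2)) \<le> (n - 1) choose (k - 1)"
    unfolding cV card_trace by (simp add: numeral_2_eq_2[symmetric] numeral_3_eq_3[symmetric])
  have "(n - 1) choose (k - 1) = ((n - 2) choose (k - 2)) + ((n - 2) choose (k - 1))"
    using choose_reduce_nat[of "n - 1" "k - 1"] k3 nk by (simp add: numeral_2_eq_2[symmetric] numeral_3_eq_3[symmetric])
  moreover have "(n - 2) choose (k - 1) = ((n - 3) choose (k - 2)) + ((n - 3) choose (k - 1))"
    using choose_reduce_nat[of "n - 2" "k - 1"] k3 nk by (simp add: numeral_2_eq_2[symmetric] numeral_3_eq_3[symmetric])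
  ultimately have "card (sec \<G> {v} {}) + ((n - 3 - 2) choose (k - 2)) \<le> ((n - 2) choose (k - 2)) + ((n - 3) choose (k - 2))"
    using le by linarith
  then have "d \<G> {v} {} + real ((n - 3 - 2) choose (k - 2)) \<le> N + real ((n - 3) choose (k - 2))"
    unfolding N_def by linarith
  then show ?thesis using choose_k2_diff[of 2] by simp
qed

text \<open>The gap in the possible degrees: a vertex is either of low degree in both families, or fewer than \<open>N\<close>
members of each family avoid it.\<close>
lemma high_degree_concentrates:
  assumes lp: "large_pair \<F> \<G>" and v: "v \<in> V" and "N + 2 * R < d \<F> {v} {}"
  shows "d \<F> {} {v} < N" "d \<G> {} {v} < N"
proof -
  show 1: "d \<G> {} {v} < N"
    using degree_drop[OF large_pair_commute[OF lp] v] assms(3) by linarith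
  have "3 * N - 2 * R \<le> real (card \<G>)" using lp by (simp add: large_pair_def)
  then have "N + 2 * R < d \<G> {v} {}"
    using 1 d_split1[OF large_pair_finite[OF large_pair_commute[OF lp]], of v] R_le N_pos by linarith
  then show "d \<F> {} {v} < N" using degree_drop[OF lp v] by linarith
qed

text \<open>The trace left by a shift that would create a vertex of high degree: few members avoid both vertices.\<close>
definition resistant :: "nat set set \<Rightarrow> nat set set \<Rightarrow> nat \<Rightarrow> nat \<Rightarrow> bool" where
  "resistant \<F> \<G> i j \<longleftrightarrow> large_pair \<F> \<G> \<and> low \<F> \<and> low \<G> \<and> i \<in> V \<and> j \<in> V \<and> i \<noteq> j
    \<and> d \<F> {} {i, j} \<le> N \<and> d \<G> {} {i, j} \<le> N"

lemma resistant_commute: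
  "resistant \<F> \<G> i j \<Longrightarrow> resistant \<G> \<F> i j" "resistant \<F> \<G> i j \<Longrightarrow> resistant \<F> \<G> j i"
  using large_pair_commute[of \<F> \<G>] unfolding resistant_def by (simp_all add: insert_commute)

text \<open>Only the degree of \<open>i\<close> can grow under the shift. Once it is high, few members of the shifted families
avoid \<open>i\<close>, and the members that avoid both \<open>i\<close> and \<open>j\<close> are not affected by the shift.\<close>
lemma resistant_if_shift_not_low:
  assumes lp: "large_pair \<F> \<G>" and low: "low \<F>" "low \<G>" and ij: "i \<in> V" "j \<in> V" "i \<noteq> j"
    and "\<not> (low (shift i j \<F>) \<and> low (shift i j \<G>))"
  shows "resistant \<F> \<G> i j"
proof -
  note lp' = large_pair_shift[OF lp ij(1), of j]
  note fin = large_pair_finite[OF lp] large_pair_finite[OF large_pair_commute[OF lp]]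
  have at_i: "N + 2 * R < d (shift i j \<H>) {i} {}" if "\<not> low (shift i j \<H>)" "low \<H>" "finite \<H>" for \<H>
  proof -
    obtain v where v: "v \<in> V" "N + 2 * R < d (shift i j \<H>) {v} {}"
      using \<open>\<not> low (shift i j \<H>)\<close> by (auto simp: low_def not_le)
    moreover have "d \<H> {v} {} \<le> N + 2 * R" using \<open>low \<H>\<close> v(1) by (simp add: low_def)
    ultimately have "v = i" using card_sec_shift_le[OF \<open>finite \<H>\<close>, of v i j] by fastforce
    then show ?thesis using v(2) by simp
  qed
  have "d (shift i j \<F>) {} {i} < N \<and> d (shift i j \<G>) {} {i} < N"
    using assms(7) at_i[OF _ low(1) fin(1)] at_i[OF _ low(2) fin(2)]
      high_degree_concentrates[OF lp' ij(1)] high_degree_concentrates[OF large_pair_commute[OF lp'] ij(1)]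
    by blast
  moreover have "d \<H> {} {i, j} \<le> d (shift i j \<H>) {} {i}" if "finite \<H>" for \<H>
  proof -
    have "finite (sec (shift i j \<H>) {} {i})" using that by (simp add: sec_def shift_def)
    then show ?thesis using card_mono[OF _ sec_avoid_shift_subset] by simp
  qed
  ultimately show ?thesis
    unfolding resistant_def using lp low ij fin by (meson less_imp_le order_trans)
qed

text \<open>At most \<open>N\<close> members avoid both points and at most \<open>N + 2 * R\<close> contain either of them, but there are
almost \<open>3 * N\<close> members. So the three classes of members that contain only \<open>i\<close>, only \<open>j\<close>, or neither
all have almost the size \<open>N\<close>.\<close>
lemma resistant_sections:
  assumes r: "resistant \<F> \<G> i j"
  shows "N - 4 * R \<le> d \<F> {i} {j}" "N - 6 * R \<le> d \<F> {} {i, j}"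
proof -
  have lp: "large_pair \<F> \<G>" and low: "d \<F> {i} {} \<le> N + 2 * R" "d \<F> {j} {} \<le> N + 2 * R"
    and ij: "i \<noteq> j" and E: "d \<F> {} {i, j} \<le> N"
    using r by (auto simp: resistant_def low_def)
  note fin = large_pair_finite[OF lp]
  have c: "3 * N - 2 * R \<le> real (card \<F>)" using lp by (simp add: large_pair_def)
  have 1: "d \<F> {} {i} = d \<F> {j} {i} + d \<F> {} {i, j}"
    using d_split[OF fin, of j "{}" "{i}"] ij by (simp add: insert_commute)
  have 2: "d \<F> {i} {} = d \<F> {i, j} {} + d \<F> {i} {j}"
    using d_split[OF fin, of j "{i}" "{}"] ij by (simp add: insert_commute)
  have 3: "d \<F> {j} {} = d \<F> {i, j} {} + d \<F> {j} {i}"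
    using d_split[OF fin, of i "{j}" "{}"] ij by simp
  have pos: "0 \<le> d \<F> {i, j} {}" by simp
  show "N - 4 * R \<le> d \<F> {i} {j}" "N - 6 * R \<le> d \<F> {} {i, j}"
    using 1 2 3 pos c low E d_split1[OF fin, of i] by linarith+
qed

text \<open>Otherwise the section of \<open>\<G>\<close> would be at least as large as the family of sets through two fixed
points besides \<open>j\<close>, and the opposite section at most as large as the family of sets that meet these two
points.\<close>
lemma link_section_small:
  assumes lp: "large_pair \<F> \<G>" and "{i, j, l} \<subseteq> V" "i \<noteq> j" "i \<noteq> l" "j \<noteq> l"
    and "2 * R < d \<F> {i, l} {j}"
  shows "d \<G> {j} {i, l} < R"
proof (rule ccontr)
  assume "\<not> ?thesis"
  then have big: "R \<le> d \<G> {j} {i, l}" by simp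
  have F: "\<F> \<subseteq> uniform V k" and G: "\<G> \<subseteq> uniform V k" and cr: "cross_intersecting \<G> \<F>"
    using lp cross_intersecting_commute by (auto simp: large_pair_def)
  have c3: "card ({j} \<union> {i, l}) = 3" using assms by simp
  have "card (sec \<F> {i, l} {j}) + ((card V - card ({j} \<union> {i, l}) - 2) choose (k - card {i, l}))
      \<le> (card V - card ({j} \<union> {i, l})) choose (k - card {i, l})"
  proof (rule section_bound[OF _ G F cr])
    have "((n - 3 - 2) choose (k - 3)) \<le> card (sec \<G> {j} {i, l})"
      using big choose_k3_le[of 2] by linarith
    then show "(card V - card ({j} \<union> {i, l}) - 2) choose (k - card {j} - 2) \<le> card (sec \<G> {j} {i, l})"
      unfolding c3 by (simp add: numeral_eq_Suc)
  qed (use assms k3 nk c3 in auto)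
  then have "card (sec \<F> {i, l} {j}) + ((n - 3 - 2) choose (k - 2)) \<le> (n - 3) choose (k - 2)"
    unfolding c3 using assms(4) by (simp add: numeral_2_eq_2[symmetric] numeral_3_eq_3[symmetric])
  then show False using choose_k2_diff[of 2] assms(6) by simp
qed

text \<open>The same argument with three fixed points.\<close>
lemma avoiding_section_small:
  assumes lp: "large_pair \<F> \<G>" and "{i, j, l} \<subseteq> V" "i \<noteq> j" "i \<noteq> l" "j \<noteq> l"
    and "3 * R < d \<G> {j, l} {i}"
  shows "d \<F> {} {i, j, l} < R"
proof (rule ccontr)
  assume "\<not> ?thesis"
  then have big: "R \<le> d \<F> {} {i, j, l}" by simp
  have F: "\<F> \<subseteq> uniform V k" and G: "\<G> \<subseteq> uniform V k" and cr: "cross_intersecting \<F> \<G>"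
    using lp by (auto simp: large_pair_def)
  have c3: "card ({} \<union> {i, j, l}) = 3" using assms by simp
  have "card (sec \<G> {j, l} {i}) + ((card V - card ({} \<union> {i, j, l}) - 3) choose (k - card {j, l}))
      \<le> (card V - card ({} \<union> {i, j, l})) choose (k - card {j, l})"
  proof (rule section_bound[OF _ F G cr])
    have "((n - 3 - 3) choose (k - 3)) \<le> card (sec \<F> {} {i, j, l})"
      using big choose_k3_le[of 3] by linarith
    then show "(card V - card ({} \<union> {i, j, l}) - 3) choose (k - card {} - 3) \<le> card (sec \<F> {} {i, j, l})"
      unfolding c3 by simp
  qed (use assms k3 nk c3 in auto)
  then have "card (sec \<G> {j, l} {i}) + ((n - 3 - 3) choose (k - 2)) \<le> (n - 3) choose (k - 2)"
    unfolding c3 using assms(5) by (simp add: numeral_2_eq_2[symmetric] numeral_3_eq_3[symmetric])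
  then show False using choose_k2_diff[of 3] assms(6) by simp
qed

text \<open>Suppose that more than \<open>2 * R\<close> members contain \<open>i\<close> and \<open>l\<close> but not \<open>j\<close>. Then almost all members of \<open>\<G>\<close>
with \<open>j\<close> but without \<open>i\<close> contain \<open>l\<close>. This in turn forces \<open>l\<close> into almost all members of \<open>\<F>\<close> that
contain \<open>i\<close> only or neither of \<open>i\<close> and \<open>j\<close>. Each of these two classes has almost \<open>N\<close> members, so
the degree of \<open>l\<close> is not low.\<close>
lemma resistant_no_third_vertex:
  assumes r: "resistant \<F> \<G> i j" and l: "l \<in> V" "l \<noteq> i" "l \<noteq> j"
  shows "d \<F> {i, l} {j} \<le> 2 * R"
proof (rule ccontr)
  assume "\<not> ?thesis"
  then have big: "2 * R < d \<F> {i, l} {j}" by simp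
  have lp: "large_pair \<F> \<G>" and V3: "{i, j, l} \<subseteq> V" "{j, i, l} \<subseteq> V" and ij: "i \<noteq> j"
    and low: "d \<F> {l} {} \<le> N + 2 * R"
    using r l by (auto simp: resistant_def low_def)
  note lp' = large_pair_commute[OF lp]
  note fF = large_pair_finite[OF lp] and fG = large_pair_finite[OF lp']
  note rG = resistant_commute(1)[OF resistant_commute(2)[OF r]]
  \<comment> \<open>Successively: \<open>l\<close> is in most members of \<open>\<G>\<close> with only \<open>j\<close>, of \<open>\<F>\<close> with neither, of \<open>\<F>\<close> with only \<open>i\<close>.\<close>
  have G1: "d \<G> {j} {i, l} < R"
    by (rule link_section_small[OF lp V3(1)]) (use ij l big in auto)
  have "d \<G> {j} {i} = d \<G> {j, l} {i} + d \<G> {j} {i, l}"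
    using d_split[OF fG, of l "{j}" "{i}"] l by (simp add: insert_commute)
  then have G2: "N - 5 * R \<le> d \<G> {j, l} {i}" using G1 resistant_sections(1)[OF rG] by linarith
  have F0: "d \<F> {} {i, j, l} < R"
    by (rule avoiding_section_small[OF lp V3(1)]) (use ij l G2 R_le N_pos in auto)
  have "d \<F> {} {i, j} = d \<F> {l} {i, j} + d \<F> {} {i, j, l}"
    using d_split[OF fF, of l "{}" "{i, j}"] l by (simp add: insert_commute)
  then have F1: "N - 7 * R \<le> d \<F> {l} {i, j}" using F0 resistant_sections(2)[OF r] by linarith
  have F2: "d \<F> {i} {j, l} < R"
    by (rule link_section_small[OF lp' V3(2)]) (use ij l G2 R_le N_pos in auto)
  have "d \<F> {i} {j} = d \<F> {i, l} {j} + d \<F> {i} {j, l}"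
    using d_split[OF fF, of l "{i}" "{j}"] l by (simp add: insert_commute)
  then have F3: "N - 5 * R \<le> d \<F> {i, l} {j}" using F2 resistant_sections(1)[OF r] by linarith
  have "d \<F> {l} {} = d \<F> {l, j} {} + d \<F> {l} {j}"
    using d_split[OF fF, of j "{l}" "{}"] l by (simp add: insert_commute)
  moreover have "d \<F> {l} {j} = d \<F> {i, l} {j} + d \<F> {l} {i, j}"
    using d_split[OF fF, of i "{l}" "{j}"] l ij by simp
  ultimately have "2 * N - 12 * R \<le> d \<F> {l} {}" using F1 F3 by simp
  then show False using low R_le N_pos by linarith
qed

text \<open>At most \<open>N\<close> members avoid either pair, so almost \<open>N\<close> members meet both of them. But by the previous
lemma each of the four crossing edges lies in at most \<open>3 * R\<close> members.\<close>
lemma no_disjoint_resistant: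
  assumes r1: "resistant \<F> \<G> i j" and r2: "resistant \<F> \<G> l m" and "{i, j} \<inter> {l, m} = {}"
  shows False
proof -
  have lp: "large_pair \<F> \<G>" using r1 by (simp add: resistant_def)
  note fin = large_pair_finite[OF lp]
  have F: "\<F> \<subseteq> uniform V k" using lp by (simp add: large_pair_def)
  have edge: "d \<F> {x, y} {} \<le> 3 * R" if "resistant \<F> \<G> x x'" "y \<in> V" "y \<noteq> x" "y \<noteq> x'" for x x' y
  proof -
    have x: "x \<in> V" "x' \<in> V" "x \<noteq> x'" using that(1) by (auto simp: resistant_def)
    have "card (sec \<F> {x', x, y} {}) \<le> (card V - card {x', x, y}) choose (k - card {x', x, y})"
      by (rule card_sec_le[OF F]) (use x that k3 in auto)
    then have "d \<F> {x', x, y} {} \<le> R"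
      using x(3) that(3,4) unfolding R_def by (simp add: numeral_2_eq_2[symmetric] numeral_3_eq_3[symmetric])
    moreover have "d \<F> {x, y} {} = d \<F> {x', x, y} {} + d \<F> {x, y} {x'}"
      using d_split[OF fin, of x' "{x, y}" "{}"] x that by simp
    ultimately show ?thesis using resistant_no_third_vertex[OF that] by linarith
  qed
  have lm: "l \<in> V" "m \<in> V" "l \<noteq> i" "l \<noteq> j" "m \<noteq> i" "m \<noteq> j" using r2 assms(3) by (auto simp: resistant_def)
  note r1' = resistant_commute(2)[OF r1]
  note edges = edge[OF r1 lm(1) lm(3) lm(4)] edge[OF r1 lm(2) lm(5) lm(6)]
    edge[OF r1' lm(1) lm(4) lm(3)] edge[OF r1' lm(2) lm(6) lm(5)]
  have "\<F> \<subseteq> sec \<F> {} {i, j} \<union> (sec \<F> {} {l, m} \<union> (sec \<F> {i, l} {} \<union> (sec \<F> {i, m} {} \<union> (sec \<F> {j, l} {} \<union> sec \<F> {j, m} {}))))"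
    by (rule subsetI) (simp add: sec_def, blast)
  then have "card \<F> \<le> card (sec \<F> {} {i, j} \<union> (sec \<F> {} {l, m} \<union> (sec \<F> {i, l} {} \<union> (sec \<F> {i, m} {} \<union> (sec \<F> {j, l} {} \<union> sec \<F> {j, m} {})))))"
    using fin by (intro card_mono) (auto simp: sec_def)
  also have "\<dots> \<le> card (sec \<F> {} {i, j}) + (card (sec \<F> {} {l, m}) + (card (sec \<F> {i, l} {})
      + (card (sec \<F> {i, m} {}) + (card (sec \<F> {j, l} {}) + card (sec \<F> {j, m} {})))))"
    by (intro order_trans[OF card_Un_le] add_left_mono order_refl)
  finally have "real (card \<F>) \<le> d \<F> {} {i, j} + (d \<F> {} {l, m} + (d \<F> {i, l} {}
      + (d \<F> {i, m} {} + (d \<F> {j, l} {} + d \<F> {j, m} {}))))"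
    by linarith
  moreover have "d \<F> {} {i, j} \<le> N" "d \<F> {} {l, m} \<le> N" using r1 r2 by (simp_all add: resistant_def)
  moreover have "3 * N - 2 * R \<le> real (card \<F>)" using lp by (simp add: large_pair_def)
  ultimately show False using edges R_le N_pos by linarith
qed

text \<open>Heavy traces would mostly contain the least vertex \<open>y\<close> outside the pair, against the bound
for a third vertex.\<close>
lemma resistant_not_heavy:
  assumes r: "resistant \<F> \<G> i j"
  shows "\<not> (\<forall>A\<in>trace \<F> {i} {j}. heavy (V - {i, j}) A)"
proof
  assume heavy: "\<forall>A\<in>trace \<F> {i} {j}. heavy (V - {i, j}) A"
  let ?Y = "V - {i, j}"
  define y where "y = Min ?Y"
  have ij: "i \<in> V" "j \<in> V" "i \<noteq> j" and lp: "large_pair \<F> \<G>" using r by (auto simp: resistant_def)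
  have F: "\<F> \<subseteq> uniform V k" using lp by (simp add: large_pair_def)
  note fin = large_pair_finite[OF lp]
  have cY: "card ?Y = n - 2" using ij by (simp add: card_Diff_subset)
  then have "card ?Y \<noteq> 0" using k3 nk by linarith
  then have "?Y \<noteq> {}" by (metis card.empty)
  then have y: "y \<in> V" "y \<noteq> i" "y \<noteq> j" using Min_in[of ?Y] by (auto simp: y_def)
  have "(\<lambda>H. H - {i}) ` sec \<F> {i} {j, y} \<subseteq> {H \<in> uniform ?Y (k - 1). Min ?Y \<notin> H \<and> heavy ?Y H}"
  proof
    fix A assume "A \<in> (\<lambda>H. H - {i}) ` sec \<F> {i} {j, y}"
    then have A: "A \<in> trace \<F> {i} {j}" "y \<notin> A" by (auto simp: trace_def sec_def)
    have "trace \<F> {i} {j} \<subseteq> uniform ?Y (k - 1)"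
      using trace_uniform[OF F, of "{i}" "{j}"] by (simp add: insert_commute)
    then show "A \<in> {H \<in> uniform ?Y (k - 1). Min ?Y \<notin> H \<and> heavy ?Y H}"
      using A heavy by (auto simp: y_def)
  qed
  then have "card (trace \<F> {i} {j, y}) \<le> card {H \<in> uniform ?Y (k - 1). Min ?Y \<notin> H \<and> heavy ?Y H}"
    unfolding trace_def by (intro card_mono) (auto simp: finite_uniform)
  also have "real \<dots> \<le> 6 / 5 * real ((card ?Y - 2) choose (k - 1 - 2))"
    by (rule card_heavy_avoiding_Min) (use k3 nk cY in auto)
  also have "(card ?Y - 2) choose (k - 1 - 2) = (n - 3 - 1) choose (k - 3)"
    unfolding cY by (simp add: numeral_eq_Suc)
  finally have "d \<F> {i} {j, y} \<le> 6 / 5 * R" using choose_k3_le[of 1] by (simp add: card_trace)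
  moreover have "d \<F> {i} {j} = d \<F> {i, y} {j} + d \<F> {i} {j, y}"
    using d_split[OF fin, of y "{i}" "{j}"] y by (simp add: insert_commute)
  ultimately show False
    using resistant_sections(1)[OF r] resistant_no_third_vertex[OF r y] R_le N_pos by linarith
qed

lemma low_not_heavy:
  assumes lp: "large_pair \<F> \<G>" and low: "low \<F>"
  shows "\<not> (\<forall>A\<in>\<F>. heavy V A)"
proof
  assume heavy: "\<forall>A\<in>\<F>. heavy V A"
  have F: "\<F> \<subseteq> uniform V k" and c: "3 * N - 2 * R \<le> real (card \<F>)" using lp by (simp_all add: large_pair_def)
  have V: "V \<noteq> {}" "finite V" using k3 nk by auto
  have "sec \<F> {} {Min V} \<subseteq> {H \<in> uniform V k. Min V \<notin> H \<and> heavy V H}"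
    using F heavy by (auto simp: sec_def)
  then have "card (sec \<F> {} {Min V}) \<le> card {H \<in> uniform V k. Min V \<notin> H \<and> heavy V H}"
    by (intro card_mono) (auto simp: finite_uniform)
  also have "real \<dots> \<le> 6 / 5 * real ((card V - 2) choose (k - 2))"
    by (rule card_heavy_avoiding_Min) (use k3 nk in auto)
  finally have "d \<F> {} {Min V} \<le> 6 / 5 * N" by (simp add: N_def)
  moreover have "d \<F> {Min V} {} \<le> N + 2 * R" using low Min_in[OF V(2,1)] by (simp add: low_def)
  ultimately show False using c d_split1[OF large_pair_finite[OF lp], of "Min V"] R_le N_pos by linarith
qed

text \<open>Shift as long as all degrees stay low. In the terminal pair any two resistant pairs of vertices share a
point. Hence both families are stable on the whole ground set, or on the ground set without one
resistant pair; by the ballot lemma one of the families, or one of the traces, consists of heavy sets.\<close>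
lemma no_low_pair:
  assumes "large_pair \<F>\<^sub>0 \<G>\<^sub>0" "low \<F>\<^sub>0" "low \<G>\<^sub>0"
  shows False
proof -
  define P where "P \<F> \<G> \<longleftrightarrow> large_pair \<F> \<G> \<and> low \<F> \<and> low \<G>" for \<F> \<G>
  have "finite \<F> \<and> finite \<G> \<and> (\<forall>H\<in>\<F> \<union> \<G>. finite H)" if "P \<F> \<G>" for \<F> \<G>
  proof -
    have "\<F> \<subseteq> uniform V k" "\<G> \<subseteq> uniform V k" using that by (simp_all add: P_def large_pair_def)
    then have "H \<subseteq> V" if "H \<in> \<F> \<union> \<G>" for H using that by (auto simp: uniform_def)
    then have "finite H" if "H \<in> \<F> \<union> \<G>" for H using that finite_subset finite_atLeastAtMost by metis
    then show ?thesis using that large_pair_finite large_pair_commute P_def by blast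
  qed
  moreover have "P \<F>\<^sub>0 \<G>\<^sub>0" using assms by (simp add: P_def)
  ultimately obtain \<F> \<G> where P: "P \<F> \<G>"
    and min: "\<And>i j. i < j \<Longrightarrow> P (shift i j \<F>) (shift i j \<G>) \<Longrightarrow> stable i j \<F> \<and> stable i j \<G>"
    using shift_minimal_pair[of P] by metis
  have lp: "large_pair \<F> \<G>" and low: "low \<F>" "low \<G>" using P by (simp_all add: P_def)
  have cr: "cross_intersecting \<F> \<G>" and sub: "\<F> \<subseteq> uniform V k" "\<G> \<subseteq> uniform V k"
    using lp by (simp_all add: large_pair_def)
  have dich: "stable i j \<F> \<and> stable i j \<G> \<or> resistant \<F> \<G> i j" if "i \<in> V" "j \<in> V" "i < j" for i j
    using min[OF that(3)] resistant_if_shift_not_low[OF lp low that(1,2)] large_pair_shift[OF lp that(1), of j] that(3)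
    unfolding P_def by blast
  show False
  proof (cases "\<exists>i j. resistant \<F> \<G> i j")
    case False
    then have st: "stable_on V \<F>" "stable_on V \<G>" unfolding stable_on_def using dich by blast+
    have "(\<forall>A\<in>\<F>. heavy V A) \<or> (\<forall>B\<in>\<G>. heavy V B)"
      by (rule stable_cross_heavy[OF st(1) cr]) (use sub in \<open>auto simp: uniform_def\<close>)
    then show False
      using low_not_heavy[OF lp low(1)] low_not_heavy[OF large_pair_commute[OF lp] low(2)] by blast
  next
    case True
    then obtain i j where r: "resistant \<F> \<G> i j" by blast
    let ?Y = "V - {i, j}"
    have ij: "i \<noteq> j" using r by (simp add: resistant_def)
    have st: "stable l m \<F> \<and> stable l m \<G>" if "l \<in> ?Y" "m \<in> ?Y" "l < m" for l m
      using dich[of l m] no_disjoint_resistant[OF r, of l m] that by auto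
    have stY: "stable_on ?Y (trace \<F> {i} {j})" "stable_on ?Y (trace \<G> {j} {i})"
      unfolding stable_on_def using st ij by (auto intro!: stable_trace)
    have "(\<forall>A\<in>trace \<F> {i} {j}. heavy ?Y A) \<or> (\<forall>B\<in>trace \<G> {j} {i}. heavy ?Y B)"
    proof (rule stable_cross_heavy[OF stY(1)])
      show "cross_intersecting (trace \<F> {i} {j}) (trace \<G> {j} {i})"
        by (rule cross_intersecting_trace[OF cr]) auto
    qed (use sub in \<open>auto simp: uniform_def trace_def sec_def\<close>)
    moreover have "\<not> (\<forall>B\<in>trace \<G> {j} {i}. heavy ?Y B)"
      using resistant_not_heavy[OF resistant_commute(1)[OF resistant_commute(2)[OF r]]]
      by (simp only: insert_commute not_False_eq_True)
    ultimately show False using resistant_not_heavy[OF r] by blast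
  qed
qed

text \<open>Otherwise every vertex is avoided by at least \<open>N\<close> members of \<open>\<F>\<close>: the factor
\<open>1 - (k - 2) / (n - 2)\<close> leaves enough room for that. Then all degrees in \<open>\<G>\<close> are low, hence
all degrees in \<open>\<F>\<close> are low as well.\<close>
lemma degree_exceeds:
  assumes lp: "large_pair \<F> \<G>"
  shows "\<exists>v\<in>V. 2 / 3 * (1 - (real k - 2) / (real n - 2)) * real (card \<F>) < d \<F> {v} {}"
proof (rule ccontr)
  assume none: "\<not> ?thesis"
  define q where "q = (real k - 2) / (real n - 2)"
  have deg: "d \<F> {v} {} \<le> 2 / 3 * (1 - q) * real (card \<F>)" if "v \<in> V" for v
    using none that by (force simp: q_def)
  note lp' = large_pair_commute[OF lp]
  have card: "3 * N - 2 * R \<le> real (card \<F>)" "3 * N - 2 * R \<le> real (card \<G>)"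
    using lp by (simp_all add: large_pair_def)
  have q: "0 \<le> q" "q \<le> 1" using k3 nk by (simp_all add: q_def field_simps)
  have Rq: "R = q * N" using R_eq k3 nk by (simp add: q_def field_simps)
  have missF: "N \<le> d \<F> {} {v}" if v: "v \<in> V" for v
  proof -
    have "N \<le> (1 / 3 + 2 / 3 * q) * (3 * N - 2 * R)"
    proof -
      have "(1 / 3 + 2 / 3 * q) * (3 * N - 2 * R) - N = 4 / 3 * (q * (1 - q)) * N"
        unfolding Rq by (simp add: algebra_simps)
      moreover have "0 \<le> 4 / 3 * (q * (1 - q)) * N" using q N_pos by simp
      ultimately show ?thesis by linarith
    qed
    also have "\<dots> \<le> (1 / 3 + 2 / 3 * q) * real (card \<F>)" using card q by (intro mult_left_mono) auto
    also have "\<dots> = real (card \<F>) - 2 / 3 * (1 - q) * real (card \<F>)" by (simp add: field_simps)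
    also have "\<dots> \<le> d \<F> {} {v}" using deg[OF v] d_split1[OF large_pair_finite[OF lp], of v] by linarith
    finally show ?thesis .
  qed
  have lowG: "d \<G> {v} {} \<le> N + 2 * R" if "v \<in> V" for v using degree_drop[OF lp that missF[OF that]] .
  have "N \<le> d \<G> {} {v}" if "v \<in> V" for v
    using lowG[OF that] card d_split1[OF large_pair_finite[OF lp'], of v] R_le N_pos by linarith
  then have "low \<F>" using degree_drop[OF lp'] by (simp add: low_def)
  moreover have "low \<G>" using lowG by (simp add: low_def)
  ultimately show False using no_low_pair[OF lp] by blast
qed

end

section \<open>The bound on the relative maximum degree\<close>

lemma ksubsets_uniform: "ksubsets n k = uniform {1..n} k"
  by (simp add: ksubsets_def uniform_def)

lemma card_link_le_rho:
  assumes "v \<in> {1..n}" "\<H> \<noteq> {}" "finite \<H>"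
  shows "real (card (link \<H> v)) \<le> rho n \<H> * real (card \<H>)"
proof -
  have "real (card (link \<H> v)) / real (card \<H>) \<le> rho n \<H>"
    unfolding rho_def using assms(1) by (intro Max_ge) auto
  moreover have "0 < real (card \<H>)" using assms by (simp add: card_gt_0_iff)
  ultimately show ?thesis by (simp add: pos_divide_le_eq)
qed

lemma rho_large_pair:
  assumes "large_ground_set n k" "large_ground_set.large_pair n k \<F> \<G>"
  shows "2 / 3 * (1 - (real k - 2) / (real n - 2)) < rho n \<F>"
proof -
  interpret large_ground_set n k by (rule assms(1))
  obtain v where v: "v \<in> V" "2 / 3 * (1 - (real k - 2) / (real n - 2)) * real (card \<F>) < d \<F> {v} {}"
    using degree_exceeds[OF assms(2)] by blast
  have fin: "finite \<F>" by (rule large_pair_finite[OF assms(2)])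
  have "0 < 3 * N - 2 * R" using R_le N_pos by linarith
  then have pos: "0 < real (card \<F>)" using assms(2) unfolding large_pair_def by linarith
  have "d \<F> {v} {} = real (card (link \<F> v))" by (simp add: card_link sec_def)
  also have "\<dots> \<le> rho n \<F> * real (card \<F>)"
    using pos by (intro card_link_le_rho[OF v(1) _ fin]) auto
  finally show ?thesis using v(2) pos by (meson less_le_trans mult_less_cancel_right_pos)
qed

lemma rho_singletons:
  assumes "39 \<le> n" "\<F> \<subseteq> ksubsets n 1" "\<G> \<subseteq> ksubsets n 1" "\<F> \<noteq> {}" "\<G> \<noteq> {}"
    and "cross_intersecting \<F> \<G>"
  shows "2 / 3 * (1 - (real 1 - 2) / (real n - 2)) < rho n \<F>"
proof -
  obtain B where B: "B \<in> \<G>" using assms by blast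
  then obtain y where y: "B = {y}" using assms(3) by (auto simp: ksubsets_def card_1_singleton_iff)
  have "F = {y}" if F: "F \<in> \<F>" for F
  proof -
    obtain x where "F = {x}" using F assms(2) by (auto simp: ksubsets_def card_1_singleton_iff)
    then show ?thesis using cross_intersectingD[OF assms(6) F B] y by auto
  qed
  then have F: "\<F> = {{y}}" using assms(4) by blast
  then have "y \<in> {1..n}" using assms(2) by (auto simp: ksubsets_def)
  then have "real (card (link \<F> y)) \<le> rho n \<F> * real (card \<F>)"
    by (intro card_link_le_rho) (simp_all add: F)
  moreover have "card (link \<F> y) = 1" unfolding card_link by (simp add: F cong: conj_cong)
  ultimately have "1 \<le> rho n \<F>" by (simp add: F)
  moreover have "2 / 3 * (1 - (real 1 - 2) / (real n - 2)) < 1"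
    using assms(1) by (simp add: field_simps)
  ultimately show ?thesis by linarith
qed

theorem theorem1p9:
  fixes n k :: nat and \<F> \<G> :: "nat set set"
  assumes "k \<ge> 1" and "k \<noteq> 2"
    and "n \<ge> 39 * k"
    and "\<F> \<subseteq> ksubsets n k" and "\<G> \<subseteq> ksubsets n k"
    and "\<F> \<noteq> {}" and "\<G> \<noteq> {}"
    and "cross_intersecting \<F> \<G>"
    and "card \<F> \<ge> card (triangle_family n k)"
    and "card \<G> \<ge> card (triangle_family n k)"
  shows "min (rho n \<F>) (rho n \<G>) > 2 / 3 * (1 - (real k - 2) / (real n - 2))"
proof (cases "k = 1")
  case True
  then show ?thesis
    using rho_singletons[of n \<F> \<G>] rho_singletons[of n \<G> \<F>] assms cross_intersecting_commute[OF assms(8)]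
    by simp
next
  case False
  then have lg: "large_ground_set n k" using assms(1-3) by unfold_locales auto
  then interpret large_ground_set n k .
  have lp: "large_pair \<F> \<G>"
    using assms card_triangle_family unfolding large_pair_def ksubsets_uniform
    by (meson of_nat_mono order_trans)
  then show ?thesis
    using rho_large_pair[OF lg lp] rho_large_pair[OF lg large_pair_commute[OF lp]] by simp
qed

end
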